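(* Let $\mathbb{F}\in\{\mathbb{R},\mathbb{C}\}$, $n\in\mathbb{N}$, $r\in\mathbb{Z}_+$, let $\mathcal{A}\in\mathbb{F}^{n\times n}/{\sim}$ and $\mathcal{B}\in\mathbb{F}^{n\times r}/{\sim}$ be nonzero patterns, and let $t_0,t_1\in\mathbb{R}$ with $t_0<t_1$. Consider the condition ($G_4$) For every non-empty subset $V\subseteq\{1,\dots,n\}$ of vertices of the graph $\mathcal{G}(\mathcal{A},\mathcal{B})$ there exists some vertex $v\in\{1,\dots,n+r\}\setminus V$ such that $V$ contains exactly one successor of $v$ in $\mathcal{G}(\mathcal{A},\mathcal{B})$. Condition ($G_4$) is equivalent to each of the following three statements. (i) Every continuous-time system $\dot x(t)=A(t)x(t)+B(t)u(t)$ of pattern $(\mathcal{A},\mathcal{B})$ is controllable on $[t_0,t_1]$. (ii) Every exponentially scaled continuous-time system $\dot x(t)=A(t)x(t)+B(t)u(t)$ of pattern $(\mathcal{A},\mathcal{B})$ is controllable on $[t_0,t_1]$. (iii) Every time-invariant continuous-time system $\dot x(t)=A(t)x(t)+B(t)u(t)$ of pattern $([\mathrm{id}]_{\sim}+\mathcal{A},\mathcal{B})$ is controllable.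
   Context: $\mathbb{Z}_+$ is the set of non-negative integers and $\mathbb{N}=\mathbb{Z}_+\setminus\{0\}$. Nonzero patterns: for $X,Y\in\mathbb{F}^{p\times q}$ write $X\sim Y$ iff the positions of the zero entries of $X$ and $Y$ coincide. The equivalence classes $[X]_{\sim}\in\mathbb{F}^{p\times q}/{\sim}$ are called (nonzero) patterns; a pattern is represented by a matrix of symbols $\star$ (nonzero entry) and $\circ$ (zero entry). Addition of patterns is defined by $[X]_{\sim}+[Y]_{\sim}=[\,|X|+|Y|\,]_{\sim}$, where $|X|$ is the matrix with entries $|X_{i,j}|$. $\mathrm{id}$ is the $n\times n$ identity matrix. $(\mathcal{A},\mathcal{B})$ is also viewed as the $n\times(n+r)$ pattern obtained by juxtaposition, $([X]_{\sim},[Y]_{\sim})=[(X,Y)]_{\sim}$. Graph: the directed graph $\mathcal{G}(\mathcal{A},\mathcal{B})$ has vertices $1,\dots,n+r$, and there is an edge from vertex $v$ to vertex $w$ iff $1\le w\le n$ and $(\mathcal{A},\mathcal{B})_{w,v}=\star$. In that case $w$ is called a successor of $v$. Systems: a continuous-time system $\dot x(t)=A(t)x(t)+B(t)u(t)$ over $\mathbb{F}$ is given by locally integrable coefficients $A\colon\mathbb{R}\to\mathbb{F}^{n\times n}$, $B\colon\mathbb{R}\to\mathbb{F}^{n\times r}$. Input signals $u$ with values in $\mathbb{F}^r$ are assumed measurable and locally essentially bounded. A solution is an absolutely continuous function satisfying the equation for almost every $t$; $\varphi(\cdot,t_0,x_0,u)$ denotes the unique solution on $[t_0,\infty)$ with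 $\varphi(t_0,t_0,x_0,u)=x_0$, and its value at $t$ depends only on $u$ restricted to $[t_0,t)$ (so $u$ need only be specified there). The system is time-invariant if $A$ and $B$ are constant. It is of pattern $(\mathcal{A},\mathcal{B})$ if $A$ and $B$ are locally integrable and $A(t)\in\mathcal{A}$, $B(t)\in\mathcal{B}$ for almost every $t\in\mathbb{R}$. It is exponentially scaled if there exist a diagonal matrix $\Lambda\in\mathbb{F}^{n\times n}$ and matrices $A_0\in\mathbb{F}^{n\times n}$, $B_0\in\mathbb{F}^{n\times r}$ such that $A(t)=e^{-\Lambda t}A_0e^{\Lambda t}-\Lambda$ and $B(t)=e^{-\Lambda t}B_0$ for every $t\in\mathbb{R}$. Controllability: a pair $(\tau_0,x_0)$ can be controlled to $(\tau_1,x_1)$ if $x_0,x_1\in\mathbb{F}^n$, $\tau_0\le\tau_1$ and there is an input $u\colon[\tau_0,\tau_1)\to\mathbb{F}^r$ with $x_1=\varphi(\tau_1,\tau_0,x_0,u)$. The system is controllable on $[t_0,t_1]$ if $(t_0,x_0)$ can be controlled to $(t_1,x_1)$ for all $x_0,x_1\in\mathbb{F}^n$. It is controllable if for all $x_0,x_1\in\mathbb{F}^n$ there exist $\tau_0,\tau_1\in\mathbb{R}$ such that $(\tau_0,x_0)$ can be controlled to $(\tau_1,x_1)$. *)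

theory Defs
  imports "HOL-Analysis.Analysis" "Jordan_Normal_Form.Matrix"
begin

text \<open>Vectors and matrices are those of \<^theory>\<open>Jordan_Normal_Form.Matrix\<close>, so that dimensions are
  natural numbers (possibly 0) and indices start at 0.  The type variable with the sort
  \<open>{real_normed_field, euclidean_space}\<close> stands for the scalar field; it is instantiated with
  \<^typ>\<open>real\<close> and \<^typ>\<open>complex\<close>.\<close>

unbundle no vec_syntax


subsection \<open>Nonzero patterns\<close>

definition same_nonzeros :: "('a::zero mat \<times> 'a mat) set" where
  "same_nonzeros = {(X, Y). dim_row X = dim_row Y \<and> dim_col X = dim_col Y \<and>
     (\<forall>i<dim_row X. \<forall>j<dim_col X. X $$ (i, j) = 0 \<longleftrightarrow> Y $$ (i, j) = 0)}"

lemma equiv_same_nonzeros: "equiv UNIV same_nonzeros"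
  by (rule equivI) (auto simp: same_nonzeros_def refl_on_def sym_def trans_def)

definition patterns :: "nat \<Rightarrow> nat \<Rightarrow> 'a::zero mat set set" where
  "patterns p q = carrier_mat p q // same_nonzeros"

definition pattern_of :: "'a::zero mat \<Rightarrow> 'a mat set" where
  "pattern_of X = same_nonzeros `` {X}"

text \<open>The operations on patterns are lifted from representatives; on equivalence classes the
  unions range over identical sets.\<close>

definition abs_mat :: "'a::real_normed_field mat \<Rightarrow> 'a mat" where
  "abs_mat X = map_mat (\<lambda>x. of_real (norm x)) X"

definition pattern_add :: "'a::real_normed_field mat set \<Rightarrow> 'a mat set \<Rightarrow> 'a mat set" where
  "pattern_add P Q = (\<Union>X\<in>P. \<Union>Y\<in>Q. pattern_of (abs_mat X + abs_mat Y))"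

definition juxt_mat :: "'a mat \<Rightarrow> 'a mat \<Rightarrow> 'a mat" where
  "juxt_mat X Y = Matrix.mat (dim_row X) (dim_col X + dim_col Y)
     (\<lambda>(i, j). if j < dim_col X then X $$ (i, j) else Y $$ (i, j - dim_col X))"

definition pattern_juxt :: "'a::zero mat set \<Rightarrow> 'a mat set \<Rightarrow> 'a mat set" where
  "pattern_juxt P Q = (\<Union>X\<in>P. \<Union>Y\<in>Q. pattern_of (juxt_mat X Y))"

definition is_star :: "'a::zero mat set \<Rightarrow> nat \<Rightarrow> nat \<Rightarrow> bool" where
  "is_star P i j \<longleftrightarrow> (\<exists>X\<in>P. X $$ (i, j) \<noteq> 0)"


subsection \<open>The graph of a pair of patterns\<close>

text \<open>Matching the matrix indices, the vertices are \<open>0, \<dots>, n + r - 1\<close> instead of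
  \<open>1, \<dots>, n + r\<close>.  An edge \<open>(v, w)\<close> leads from \<open>v\<close> to \<open>w\<close>.\<close>

definition pattern_edges :: "nat \<Rightarrow> nat \<Rightarrow> 'a::zero mat set \<Rightarrow> 'a mat set \<Rightarrow> nat rel" where
  "pattern_edges n r P Q =
     {(v, w). v < n + r \<and> w < n \<and> is_star (pattern_juxt P Q) w v}"

definition cond_G4 :: "nat \<Rightarrow> nat \<Rightarrow> 'a::zero mat set \<Rightarrow> 'a mat set \<Rightarrow> bool" where
  "cond_G4 n r P Q \<longleftrightarrow>
     (\<forall>V. V \<noteq> {} \<and> V \<subseteq> {0..<n} \<longrightarrow>
        (\<exists>v \<in> {0..<n + r} - V. \<exists>!w. w \<in> V \<and> (v, w) \<in> pattern_edges n r P Q))"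


subsection \<open>Continuous-time linear systems\<close>

definition locally_integrable :: "(real \<Rightarrow> 'a::euclidean_space) \<Rightarrow> bool" where
  "locally_integrable f \<longleftrightarrow> (\<forall>a b. f absolutely_integrable_on {a..b})"

definition ct_system ::
  "nat \<Rightarrow> nat \<Rightarrow> (real \<Rightarrow> 'a::{real_normed_field, euclidean_space} mat) \<Rightarrow> (real \<Rightarrow> 'a mat) \<Rightarrow> bool" where
  "ct_system n r A B \<longleftrightarrow>
     (\<forall>t. A t \<in> carrier_mat n n \<and> B t \<in> carrier_mat n r) \<and>
     (\<forall>i<n. \<forall>j<n. locally_integrable (\<lambda>t. A t $$ (i, j))) \<and>
     (\<forall>i<n. \<forall>j<r. locally_integrable (\<lambda>t. B t $$ (i, j)))"

definition of_pattern ::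
  "'a::{real_normed_field, euclidean_space} mat set \<Rightarrow> 'a mat set \<Rightarrow>
   (real \<Rightarrow> 'a mat) \<Rightarrow> (real \<Rightarrow> 'a mat) \<Rightarrow> bool" where
  "of_pattern P Q A B \<longleftrightarrow> (AE t in lebesgue. A t \<in> P \<and> B t \<in> Q)"

definition time_invariant :: "(real \<Rightarrow> 'a mat) \<Rightarrow> (real \<Rightarrow> 'a mat) \<Rightarrow> bool" where
  "time_invariant A B \<longleftrightarrow> (\<exists>A0 B0. \<forall>t. A t = A0 \<and> B t = B0)"

definition mat_exp :: "'a::{real_normed_field, euclidean_space} mat \<Rightarrow> 'a mat" where
  "mat_exp M = Matrix.mat (dim_row M) (dim_row M)
     (\<lambda>(i, j). \<Sum>k. (M ^\<^sub>m k) $$ (i, j) /\<^sub>R fact k)"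

definition exponentially_scaled ::
  "nat \<Rightarrow> nat \<Rightarrow> (real \<Rightarrow> 'a::{real_normed_field, euclidean_space} mat) \<Rightarrow> (real \<Rightarrow> 'a mat) \<Rightarrow> bool" where
  "exponentially_scaled n r A B \<longleftrightarrow>
     (\<exists>L \<in> carrier_mat n n. \<exists>A0 \<in> carrier_mat n n. \<exists>B0 \<in> carrier_mat n r. diagonal_mat L \<and>
        (\<forall>t. A t = mat_exp (of_real (-t) \<cdot>\<^sub>m L) * A0 * mat_exp (of_real t \<cdot>\<^sub>m L) - L \<and>
             B t = mat_exp (of_real (-t) \<cdot>\<^sub>m L) * B0))"


subsection \<open>Inputs, solutions and controllability\<close>

text \<open>Inputs are defined on the whole real line; by local essential boundedness this amounts to
  measurable and essentially bounded inputs on each \<open>[\<tau>\<^sub>0, \<tau>\<^sub>1)\<close>, as those extend by zero.\<close>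

definition input_signal ::
  "nat \<Rightarrow> (real \<Rightarrow> 'a::{real_normed_field, euclidean_space} vec) \<Rightarrow> bool" where
  "input_signal r u \<longleftrightarrow>
     (\<forall>t. u t \<in> carrier_vec r) \<and>
     (\<forall>i<r. (\<lambda>t. u t $ i) \<in> borel_measurable lebesgue) \<and>
     (\<forall>i<r. \<forall>a b. \<exists>M. AE t in lebesgue. t \<in> {a..b} \<longrightarrow> norm (u t $ i) \<le> M)"

text \<open>The elements of \<open>d\<close> below are non-overlapping compact intervals \<open>[Inf K, Sup K]\<close>.\<close>

definition abs_continuous_on :: "real set \<Rightarrow> (real \<Rightarrow> 'a::real_normed_vector) \<Rightarrow> bool" where
  "abs_continuous_on S f \<longleftrightarrow>
     (\<forall>\<epsilon>>0. \<exists>\<delta>>0. \<forall>d. d division_of \<Union>d \<and> \<Union>d \<subseteq> S \<and> (\<Sum>K\<in>d. measure lborel K) < \<delta> \<longrightarrow>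
        (\<Sum>K\<in>d. norm (f (Sup K) - f (Inf K))) < \<epsilon>)"

text \<open>Solutions live on \<open>[\<tau>, \<infinity>)\<close>, where absolute continuity is required on compact
  subintervals.  Vector-valued notions are understood componentwise.\<close>

definition solution ::
  "nat \<Rightarrow> (real \<Rightarrow> 'a::{real_normed_field, euclidean_space} mat) \<Rightarrow> (real \<Rightarrow> 'a mat) \<Rightarrow>
   real \<Rightarrow> (real \<Rightarrow> 'a vec) \<Rightarrow> (real \<Rightarrow> 'a vec) \<Rightarrow> bool" where
  "solution n A B \<tau> u x \<longleftrightarrow>
     (\<forall>t\<ge>\<tau>. x t \<in> carrier_vec n) \<and>
     (\<forall>i<n. \<forall>T\<ge>\<tau>. abs_continuous_on {\<tau>..T} (\<lambda>t. x t $ i)) \<and>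
     (AE t in lebesgue. t \<ge> \<tau> \<longrightarrow>
        (\<forall>i<n. ((\<lambda>s. x s $ i) has_vector_derivative
                  (A t *\<^sub>v x t + B t *\<^sub>v u t) $ i) (at t within {\<tau>..})))"

text \<open>Since the solution with \<open>x \<tau>\<^sub>0 = x\<^sub>0\<close> is unique, \<open>x \<tau>\<^sub>1\<close> below is
  \<open>\<phi>(\<tau>\<^sub>1, \<tau>\<^sub>0, x\<^sub>0, u)\<close>.\<close>

definition can_be_controlled ::
  "nat \<Rightarrow> nat \<Rightarrow> (real \<Rightarrow> 'a::{real_normed_field, euclidean_space} mat) \<Rightarrow> (real \<Rightarrow> 'a mat) \<Rightarrow>
   real \<Rightarrow> 'a vec \<Rightarrow> real \<Rightarrow> 'a vec \<Rightarrow> bool" where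
  "can_be_controlled n r A B \<tau>0 x0 \<tau>1 x1 \<longleftrightarrow>
     x0 \<in> carrier_vec n \<and> x1 \<in> carrier_vec n \<and> \<tau>0 \<le> \<tau>1 \<and>
     (\<exists>u x. input_signal r u \<and> solution n A B \<tau>0 u x \<and> x \<tau>0 = x0 \<and> x \<tau>1 = x1)"

definition controllable_on ::
  "nat \<Rightarrow> nat \<Rightarrow> (real \<Rightarrow> 'a::{real_normed_field, euclidean_space} mat) \<Rightarrow> (real \<Rightarrow> 'a mat) \<Rightarrow>
   real \<Rightarrow> real \<Rightarrow> bool" where
  "controllable_on n r A B t0 t1 \<longleftrightarrow>
     (\<forall>x0 \<in> carrier_vec n. \<forall>x1 \<in> carrier_vec n. can_be_controlled n r A B t0 x0 t1 x1)"

definition controllable ::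
  "nat \<Rightarrow> nat \<Rightarrow> (real \<Rightarrow> 'a::{real_normed_field, euclidean_space} mat) \<Rightarrow> (real \<Rightarrow> 'a mat) \<Rightarrow> bool" where
  "controllable n r A B \<longleftrightarrow>
     (\<forall>x0 \<in> carrier_vec n. \<forall>x1 \<in> carrier_vec n. \<exists>\<tau>0 \<tau>1. can_be_controlled n r A B \<tau>0 x0 \<tau>1 x1)"

end

theory Submission
  imports Defs "HOL-Probability.Discrete_Topology"
begin

text \<open>The theorem rests on the duality between steering a state and observing a costate, that is, a
  solution of \<open>p' = - A\<^sup>T p\<close>.

  Condition (\<open>G\<^sub>4\<close>) suffices.  The states reachable from 0 at time \<open>t1\<close> form a subspace.  If it
  is proper, it is annihilated by some \<open>q \<noteq> 0\<close>, and the costate with \<open>p(t1) = q\<close> satisfies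
  \<open>\<integral> p\<^sup>T B u = 0\<close> for every bounded input \<open>u\<close>, so that \<open>B\<^sup>T p = 0\<close> almost everywhere
  (\<open>controllable_if_observable\<close>).  The graph condition leaves no such costate.  At a time at which
  the number of nonzero components of \<open>p\<close> is maximal, the set \<open>V\<close> of these components does not change
  nearby (\<open>stable_support\<close>).  Let \<open>v \<notin> V\<close> be a vertex with exactly one successor \<open>w\<close> in \<open>V\<close>.  The
  equation for \<open>v\<close>, which is a row of the costate equation with \<open>p\<^sub>v = 0\<close> or a row of \<open>B\<^sup>T p = 0\<close>,
  then says that the product of \<open>p\<^sub>w\<close> and the entry at \<open>(w, v)\<close> vanishes near that time, although both
  factors are nonzero almost everywhere there (\<open>sole_successor_costate_eq_0\<close>).  Hence (i), and (ii) is a special case.  Since \<open>v \<notin> V\<close>,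
  the condition ignores diagonal entries of \<open>A\<close>, and (iii) follows as well.

  Condition (\<open>G\<^sub>4\<close>) is necessary.  If it fails for \<open>V\<close>, every vertex outside \<open>V\<close> has no successor or
  at least two successors in \<open>V\<close>, so that nonzero numbers with sum 0 can be placed on the stars which
  its column has in the rows of \<open>V\<close>.  In the columns of \<open>V\<close> the diagonal entry can be adjusted: in
  (ii) it is shifted by \<open>\<Lambda>\<close>, and in (iii) it is an arbitrary nonzero number.  Both times a
  costate of the form \<open>p\<^sub>i(t) = exp (\<mu>\<^sub>i t)\<close> for \<open>i \<in> V\<close> and \<open>p\<^sub>i = 0\<close> otherwise
  is annihilated by \<open>B\<^sup>T\<close>.  Then \<open>p\<^sup>T x\<close> is constant along solutions, whatever the
  input (\<open>exponential_costate_not_controlled\<close>).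

  As the coefficients are merely locally integrable, the calculus used here is that of absolutely
  continuous functions: they are the integrals of their almost everywhere derivatives
  (\<open>abs_continuous_on_has_integral\<close>), indefinite integrals are absolutely continuous and almost
  everywhere differentiable (\<open>abs_continuous_on_integral\<close>, \<open>AE_has_vector_derivative_integral\<close>), and
  linear equations have global solutions in this sense (\<open>solution_exists\<close>).\<close>

unbundle no vec_syntax

section \<open>Absolutely continuous functions\<close>

text \<open>One criterion covers sums, products and Lipschitz images of absolutely continuous functions.\<close>

lemma abs_continuous_on_dominated:
  fixes f :: "real \<Rightarrow> 'a::real_normed_vector" and g :: "real \<Rightarrow> 'b::real_normed_vector"
    and h :: "real \<Rightarrow> 'c::real_normed_vector"
  assumes f: "abs_continuous_on S f" and g: "abs_continuous_on S g"
    and le: "\<And>s t. s \<in> S \<Longrightarrow> t \<in> S \<Longrightarrow> norm (h t - h s) \<le> C * (norm (f t - f s) + norm (g t - g s))"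
  shows "abs_continuous_on S h"
  unfolding abs_continuous_on_def
proof (intro allI impI)
  fix \<epsilon> :: real assume "\<epsilon> > 0"
  define D where "D = max C 1"
  have D: "D > 0" "C \<le> D" by (auto simp: D_def)
  define \<epsilon>' where "\<epsilon>' = \<epsilon> / (2 * D)"
  have "\<epsilon>' > 0" using \<open>\<epsilon> > 0\<close> D by (simp add: \<epsilon>'_def)
  obtain \<delta>1 where \<delta>1: "\<delta>1 > 0" "\<And>d. d division_of \<Union>d \<Longrightarrow> \<Union>d \<subseteq> S \<Longrightarrow> (\<Sum>K\<in>d. measure lborel K) < \<delta>1 \<Longrightarrow>
        (\<Sum>K\<in>d. norm (f (Sup K) - f (Inf K))) < \<epsilon>'"
    using f \<open>\<epsilon>' > 0\<close> unfolding abs_continuous_on_def by metis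
  obtain \<delta>2 where \<delta>2: "\<delta>2 > 0" "\<And>d. d division_of \<Union>d \<Longrightarrow> \<Union>d \<subseteq> S \<Longrightarrow> (\<Sum>K\<in>d. measure lborel K) < \<delta>2 \<Longrightarrow>
        (\<Sum>K\<in>d. norm (g (Sup K) - g (Inf K))) < \<epsilon>'"
    using g \<open>\<epsilon>' > 0\<close> unfolding abs_continuous_on_def by metis
  show "\<exists>\<delta>>0. \<forall>d. d division_of \<Union>d \<and> \<Union>d \<subseteq> S \<and> (\<Sum>K\<in>d. measure lborel K) < \<delta> \<longrightarrow>
        (\<Sum>K\<in>d. norm (h (Sup K) - h (Inf K))) < \<epsilon>"
  proof (intro exI conjI allI impI)
    show "min \<delta>1 \<delta>2 > 0" using \<delta>1 \<delta>2 by simp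
    fix d assume d: "d division_of \<Union>d \<and> \<Union>d \<subseteq> S \<and> (\<Sum>K\<in>d. measure lborel K) < min \<delta>1 \<delta>2"
    have ends: "Sup K \<in> S \<and> Inf K \<in> S" if Kd: "K \<in> d" for K
    proof -
      obtain u v where uv: "K = cbox u v" "K \<noteq> {}" using division_ofD(3)[OF conjunct1[OF d] Kd] division_ofD(4)[OF conjunct1[OF d] Kd] by blast
      then have "Sup K \<in> K" "Inf K \<in> K" by auto
      then show ?thesis using d that by blast
    qed
    have "(\<Sum>K\<in>d. norm (h (Sup K) - h (Inf K))) \<le>
        (\<Sum>K\<in>d. D * (norm (f (Sup K) - f (Inf K)) + norm (g (Sup K) - g (Inf K))))"
    proof (rule sum_mono)
      fix K assume "K \<in> d"
      then have "norm (h (Sup K) - h (Inf K)) \<le> C * (norm (f (Sup K) - f (Inf K)) + norm (g (Sup K) - g (Inf K)))"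
        using ends le by blast
      also have "\<dots> \<le> D * (norm (f (Sup K) - f (Inf K)) + norm (g (Sup K) - g (Inf K)))"
        using D by (intro mult_right_mono) auto
      finally show "norm (h (Sup K) - h (Inf K)) \<le> D * (norm (f (Sup K) - f (Inf K)) + norm (g (Sup K) - g (Inf K)))" .
    qed
    also have "\<dots> = D * ((\<Sum>K\<in>d. norm (f (Sup K) - f (Inf K))) + (\<Sum>K\<in>d. norm (g (Sup K) - g (Inf K))))"
      by (simp only: sum_distrib_left[symmetric] sum.distrib)
    also have "\<dots> < D * (\<epsilon>' + \<epsilon>')"
      using d D \<delta>1(2)[of d] \<delta>2(2)[of d] by (intro mult_strict_left_mono add_strict_mono) auto
    also have "\<dots> = \<epsilon>" using D by (simp add: \<epsilon>'_def)
    finally show "(\<Sum>K\<in>d. norm (h (Sup K) - h (Inf K))) < \<epsilon>" .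
  qed
qed

text \<open>The fundamental theorem of calculus for absolutely continuous functions.  Outside the null set \<open>N\<close>
  of bad points a fine enough gauge makes \<open>f' x\<close> approximate the increments of \<open>f\<close>.  Around the
  points of \<open>N\<close> the gauge keeps the intervals of a tagged division within an open set of small
  measure, where absolute continuity makes the increments of \<open>f\<close> small in total.\<close>

lemma abs_continuous_on_has_integral:
  fixes f :: "real \<Rightarrow> 'a::euclidean_space"
  assumes "a \<le> b" and ac: "abs_continuous_on {a..b} f"
    and der: "AE t in lebesgue. t \<in> {a..b} \<longrightarrow> (f has_vector_derivative f' t) (at t within {a..b})"
  shows "(f' has_integral (f b - f a)) {a..b}"
proof -
  define N where "N = {t \<in> {a..b}. \<not> (f has_vector_derivative f' t) (at t within {a..b})}"
  have "negligible N"
  proof -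
    obtain M where M: "negligible M" "{t. \<not> (t \<in> {a..b} \<longrightarrow> (f has_vector_derivative f' t) (at t within {a..b}))} \<subseteq> M"
      using der unfolding eventually_ae_filter_negligible by blast
    show ?thesis by (rule negligible_subset[OF M(1)]) (use M(2) in \<open>auto simp: N_def\<close>)
  qed
  \<comment> \<open>changing the derivative on a null set removes the terms tagged in \<open>N\<close> from the Riemann sums\<close>
  define g where "g t = (if t \<in> N then 0 else f' t)" for t
  have "(g has_integral (f b - f a)) (cbox a b)"
    unfolding has_integral_factor_content
  proof safe
    fix e :: real assume "e > 0"
    show "\<exists>d. gauge d \<and> (\<forall>p. p tagged_division_of (cbox a b) \<and> d fine p \<longrightarrow>
      norm ((\<Sum>(x,K)\<in>p. measure lborel K *\<^sub>R g x) - (f b - f a)) \<le> e * measure lborel (cbox a b))"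
    proof (cases "a = b")
      case True
      have "gauge (\<lambda>x::real. ball x 1)" by (simp add: gauge_ball)
      moreover have "(\<Sum>(x,K)\<in>p. measure lborel K *\<^sub>R g x) = 0" if "p tagged_division_of (cbox a b)" for p
        using that True by (intro sum_content_null[of a b]) (auto)
      ultimately show ?thesis using True by (intro exI[of _ "\<lambda>x. ball x 1"]) auto
    next
      case False
      with \<open>a \<le> b\<close> have "a < b" by simp
      define \<epsilon> where "\<epsilon> = e / 2 * (b - a)"
      have "\<epsilon> > 0" using \<open>e > 0\<close> \<open>a < b\<close> by (simp add: \<epsilon>_def)
      obtain \<delta> where \<delta>: "\<delta> > 0" "\<And>d. d division_of \<Union>d \<Longrightarrow> \<Union>d \<subseteq> {a..b} \<Longrightarrow> (\<Sum>K\<in>d. measure lborel K) < \<delta> \<Longrightarrow>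
          (\<Sum>K\<in>d. norm (f (Sup K) - f (Inf K))) < \<epsilon>"
        using ac \<open>\<epsilon> > 0\<close> unfolding abs_continuous_on_def by metis
      have nullN: "N \<in> null_sets lebesgue" using \<open>negligible N\<close> by (simp add: negligible_iff_null_sets)
      then obtain U where U: "open U" "N \<subseteq> U" "U - N \<in> lmeasurable" "emeasure lebesgue (U - N) < ennreal \<delta>"
        using sets_lebesgue_outer_open[OF null_setsD2 \<delta>(1)] by metis
      have "N \<in> lmeasurable" using \<open>negligible N\<close> by (rule negligible_imp_measurable)
      then have U_meas: "U \<in> lmeasurable"
        using fmeasurable.Un[OF U(3)] U(2) by (metis Diff_partition sup_commute)
      have "measure lebesgue U = measure lebesgue (U - N)"
        using measure_Diff_null_set[OF fmeasurableD[OF U_meas] nullN] by simp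
      then have U_small: "measure lebesgue U < \<delta>"
        using U(3,4) by (simp add: emeasure_eq_measure2 ennreal_less_iff)
      have "\<exists>d>0. (x \<in> N \<longrightarrow> ball x d \<subseteq> U) \<and> (x \<in> {a..b} - N \<longrightarrow>
         (\<forall>y\<in>{a..b}. norm (y-x) < d \<longrightarrow> norm (f y - f x - (y-x) *\<^sub>R f' x) \<le> e/2 * norm (y-x)))" for x
      proof (cases "x \<in> N")
        case True
        then show ?thesis using U openE by (metis Diff_iff subsetD)
      next
        case False
        show ?thesis
        proof (cases "x \<in> {a..b}")
          case True
          then have "(f has_vector_derivative f' x) (at x within {a..b})" using False by (auto simp: N_def)
          then show ?thesis using False \<open>e > 0\<close>
            unfolding has_vector_derivative_def has_derivative_within_alt by (meson half_gt_zero)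
        qed (use False in \<open>auto intro: exI[of _ 1]\<close>)
      qed
      then obtain d where d: "\<And>x. d x > 0" "\<And>x. x \<in> N \<Longrightarrow> ball x (d x) \<subseteq> U"
        "\<And>x y. x \<in> {a..b} - N \<Longrightarrow> y \<in> {a..b} \<Longrightarrow> norm (y-x) < d x \<Longrightarrow>
            norm (f y - f x - (y-x) *\<^sub>R f' x) \<le> e/2 * norm (y-x)"
        by metis
      show ?thesis
      proof (intro exI conjI allI impI)
        show "gauge (\<lambda>x. ball x (d x))" using d(1) by (simp add: gauge_def)
        fix p assume p: "p tagged_division_of (cbox a b) \<and> (\<lambda>x. ball x (d x)) fine p"
        then have ptag: "p tagged_division_of {a..b}" and fine: "(\<lambda>x. ball x (d x)) fine p" by auto
        note finp = tagged_division_of_finite[OF ptag]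
        define q where "q = {(x,K)\<in>p. x \<in> N}"
        have "q \<subseteq> p" by (auto simp: q_def)
        let ?\<Delta> = "\<lambda>K. f (Sup K) - f (Inf K)"
        have good: "norm (measure lborel K *\<^sub>R g x - ?\<Delta> K) \<le> e/2 * measure lborel K" if xK: "(x,K) \<in> p - q" for x K
        proof -
          have xK': "(x,K) \<in> p" "x \<notin> N" using xK by (auto simp: q_def)
          obtain u v where k: "K = cbox u v" "x \<in> K" "K \<subseteq> {a..b}"
            using tagged_division_ofD(2-4)[OF ptag xK'(1)] by blast
          then have uv: "u \<le> x" "x \<le> v" "u \<le> v" "u \<in> {a..b}" "v \<in> {a..b}" "x \<in> {a..b}" by auto
          have "K \<subseteq> ball x (d x)" using fine xK' by (auto simp: fine_def)
          moreover have "u \<in> K" "v \<in> K" using k uv by auto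
          ultimately have "norm (u - x) < d x" "norm (v - x) < d x" by (auto simp: dist_norm norm_minus_commute)
          then have 1: "norm (f u - f x - (u-x) *\<^sub>R f' x) \<le> e/2 * (x - u)"
                and 2: "norm (f v - f x - (v-x) *\<^sub>R f' x) \<le> e/2 * (v - x)"
            using d(3)[of x u] d(3)[of x v] uv xK'(2) by auto
          have "measure lborel K *\<^sub>R g x - ?\<Delta> K = (f u - f x - (u-x) *\<^sub>R f' x) - (f v - f x - (v-x) *\<^sub>R f' x)"
            using k uv xK'(2) by (simp add: g_def algebra_simps)
          also have "norm \<dots> \<le> e/2 * (x-u) + e/2 * (v-x)"
            using 1 2 by (meson add_mono norm_triangle_ineq4 order_trans)
          also have "\<dots> = e/2 * measure lborel K" using k uv by (simp add: algebra_simps add_divide_distrib diff_divide_distrib)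
          finally show ?thesis .
        qed
        have qpart: "q tagged_partial_division_of {a..b}"
          using tagged_partial_division_subset[OF _ \<open>q \<subseteq> p\<close>] ptag tagged_division_of_def by blast
        then have qtag: "q tagged_division_of \<Union>(snd ` q)"
          by (rule tagged_partial_division_of_Union_self)
        have snd_div: "(snd ` q) division_of \<Union>(snd ` q)"
          by (rule division_of_tagged_division[OF qtag])
        have sub_ab: "\<Union>(snd ` q) \<subseteq> {a..b}"
          using qpart by (auto simp: tagged_partial_division_of_def subset_iff)
        have sub_U: "\<Union>(snd ` q) \<subseteq> U"
        proof safe
          fix x K y assume "(x,K) \<in> q" "y \<in> snd (x,K)"
          then have "(x,K) \<in> p" "y \<in> K" "x \<in> N" by (auto simp: q_def)
          then have "y \<in> ball x (d x)" using fineD[OF fine] by blast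
          then show "y \<in> U" using d(2)[OF \<open>x \<in> N\<close>] by blast
        qed
        have "(\<Sum>K\<in>snd ` q. measure lborel K) = measure lebesgue (\<Union>(snd ` q))"
        proof -
          have "(\<Sum>K\<in>snd ` q. measure lborel K) = (\<Sum>K\<in>snd ` q. measure lebesgue K)"
          proof (rule sum.cong[OF refl])
            fix K assume "K \<in> snd ` q"
            then obtain u v where "K = cbox u v" using division_ofD(4)[OF snd_div] by blast
            then show "measure lborel K = measure lebesgue K" by simp
          qed
          then show ?thesis using content_division[OF snd_div] by simp
        qed
        also have "\<dots> \<le> measure lebesgue U"
          using sub_U U_meas by (intro measure_mono_fmeasurable)
             (auto intro!: fmeasurableD lmeasurable_division[OF snd_div])
        also have "\<dots> < \<delta>" by (rule U_small)
        finally have small: "(\<Sum>K\<in>snd ` q. norm (?\<Delta> K)) < \<epsilon>"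
          using \<delta>(2)[OF snd_div sub_ab] by simp
        have "(\<Sum>(x,K)\<in>q. norm (?\<Delta> K)) = (\<Sum>K\<in>snd ` q. norm (?\<Delta> K))"
        proof -
          \<comment> \<open>tags may share a degenerate interval, on which the increment vanishes\<close>
          let ?\<Delta>' = "\<lambda>K. if K = {} then 0 else norm (?\<Delta> K)"
          have "(\<Sum>(x,K)\<in>q. ?\<Delta>' K) = (\<Sum>K\<in>snd ` q. ?\<Delta>' K)"
          proof (rule sum.over_tagged_division_lemma[OF qtag])
            fix u v :: real assume "box u v = {}"
            then show "?\<Delta>' (cbox u v) = 0" by (cases "u = v") (auto simp: box_real)
          qed
          moreover have "(\<Sum>(x,K)\<in>q. ?\<Delta>' K) = (\<Sum>(x,K)\<in>q. norm (?\<Delta> K))"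
            using tagged_division_ofD(2)[OF qtag] by (intro sum.cong) fastforce+
          moreover have "(\<Sum>K\<in>snd ` q. ?\<Delta>' K) = (\<Sum>K\<in>snd ` q. norm (?\<Delta> K))"
            using tagged_division_ofD(2)[OF qtag] by (intro sum.cong) fastforce+
          ultimately show ?thesis by simp
        qed
        then have bad: "(\<Sum>(x,K)\<in>q. norm (?\<Delta> K)) < \<epsilon>" using small by simp
        have "(\<Sum>(x,K)\<in>p. measure lborel K *\<^sub>R g x) - (f b - f a) = (\<Sum>(x,K)\<in>p. measure lborel K *\<^sub>R g x - ?\<Delta> K)"
          using additive_tagged_division_1[OF \<open>a \<le> b\<close> ptag, of f]
          by (simp add: sum_subtractf split_def)
        also have "\<dots> = (\<Sum>(x,K)\<in>p - q. measure lborel K *\<^sub>R g x - ?\<Delta> K) + (\<Sum>(x,K)\<in>q. measure lborel K *\<^sub>R g x - ?\<Delta> K)"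
          using sum.subset_diff[OF \<open>q \<subseteq> p\<close> finp] by blast
        also have "(\<Sum>(x,K)\<in>q. measure lborel K *\<^sub>R g x - ?\<Delta> K) = (\<Sum>(x,K)\<in>q. - ?\<Delta> K)"
          by (rule sum.cong) (auto simp: q_def g_def)
        also have "norm ((\<Sum>(x,K)\<in>p - q. measure lborel K *\<^sub>R g x - ?\<Delta> K) + (\<Sum>(x,K)\<in>q. - ?\<Delta> K))
           \<le> (\<Sum>(x,K)\<in>p - q. e/2 * measure lborel K) + (\<Sum>(x,K)\<in>q. norm (?\<Delta> K))"
        proof (rule order_trans[OF norm_triangle_ineq add_mono])
          show "norm (\<Sum>(x,K)\<in>p - q. measure lborel K *\<^sub>R g x - ?\<Delta> K) \<le> (\<Sum>(x,K)\<in>p - q. e/2 * measure lborel K)"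
            using good by (intro sum_norm_le) auto
          show "norm (\<Sum>(x,K)\<in>q. - ?\<Delta> K) \<le> (\<Sum>(x,K)\<in>q. norm (?\<Delta> K))"
            by (rule sum_norm_le) (auto simp: norm_minus_commute)
        qed
        also have "(\<Sum>(x,K)\<in>p - q. e/2 * measure lborel K) \<le> (\<Sum>(x,K)\<in>p. e/2 * measure lborel K)"
          using \<open>e > 0\<close> finp by (intro sum_mono2) auto
        also have "(\<Sum>(x,K)\<in>p. e/2 * measure lborel K) = e/2 * (b - a)"
        proof -
          have "(\<Sum>(x,K)\<in>p. measure lborel K) = b - a"
            using additive_content_tagged_division[of p a b] ptag \<open>a \<le> b\<close> by simp
          then show ?thesis by (simp only: split_def sum_distrib_left[symmetric])
        qed
        finally show "norm ((\<Sum>(x,K)\<in>p. measure lborel K *\<^sub>R g x) - (f b - f a)) \<le> e * measure lborel (cbox a b)"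
          using bad \<open>a \<le> b\<close> by (simp add: \<epsilon>_def)
      qed
    qed
  qed
  then have "(g has_integral (f b - f a)) {a..b}" by simp
  then show ?thesis
    by (rule has_integral_spike[OF \<open>negligible N\<close>, rotated]) (auto simp: g_def)
qed

lemma abs_continuous_on_imp_continuous_on:
  fixes f :: "real \<Rightarrow> 'a::real_normed_vector"
  assumes ac: "abs_continuous_on {a..b} f"
  shows "continuous_on {a..b} f"
  unfolding continuous_on_iff
proof (intro ballI allI impI)
  fix s e :: real assume s: "s \<in> {a..b}" and "e > 0"
  obtain \<delta> where \<delta>: "\<delta> > 0" "\<And>d. d division_of \<Union>d \<Longrightarrow> \<Union>d \<subseteq> {a..b} \<Longrightarrow> (\<Sum>K\<in>d. measure lborel K) < \<delta> \<Longrightarrow>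
      (\<Sum>K\<in>d. norm (f (Sup K) - f (Inf K))) < e"
    using ac \<open>e > 0\<close> unfolding abs_continuous_on_def by metis
  have key: "norm (f (max s t) - f (min s t)) < e" if t: "t \<in> {a..b}" "dist t s < \<delta>" for t
  proof -
    let ?K = "cbox (min s t) (max s t)"
    have "?K \<noteq> {}" by simp
    then have "{?K} division_of \<Union>{?K}" by (simp only: ccpo_Sup_singleton division_of_self simp_thms)
    moreover have "\<Union>{?K} \<subseteq> {a..b}" using s t(1) by auto
    moreover have "(\<Sum>K\<in>{?K}. measure lborel K) < \<delta>" using t(2) by (auto simp: dist_real_def)
    ultimately show ?thesis using \<delta>(2)[of "{?K}"] by simp
  qed
  have "dist (f t) (f s) < e" if "t \<in> {a..b}" "dist t s < \<delta>" for t
    using key[OF that] by (cases "s \<le> t") (simp_all add: dist_norm norm_minus_commute max_def min_def)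
  then show "\<exists>d>0. \<forall>t\<in>{a..b}. dist t s < d \<longrightarrow> dist (f t) (f s) < e" using \<delta>(1) by blast
qed

lemma abs_continuous_on_const: "abs_continuous_on S (\<lambda>t. c)"
  unfolding abs_continuous_on_def by (auto intro: exI[of _ 1])

lemma abs_continuous_on_add:
  assumes "abs_continuous_on S f" "abs_continuous_on S g"
  shows "abs_continuous_on S (\<lambda>t. f t + g t)"
proof (rule abs_continuous_on_dominated[OF assms, of _ 1])
  show "norm (f t + g t - (f s + g s)) \<le> 1 * (norm (f t - f s) + norm (g t - g s))" for s t
    using norm_triangle_ineq[of "f t - f s" "g t - g s"] by (simp add: algebra_simps)
qed

lemma abs_continuous_on_sum:
  assumes "\<And>i. i \<in> I \<Longrightarrow> abs_continuous_on S (f i)"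
  shows "abs_continuous_on S (\<lambda>t. \<Sum>i\<in>I. f i t)"
  using assms
  by (induction I rule: infinite_finite_induct) (auto intro: abs_continuous_on_const abs_continuous_on_add)

lemma abs_continuous_on_mult:
  fixes f g :: "real \<Rightarrow> 'a::real_normed_algebra"
  assumes f: "abs_continuous_on {a..b} f" and g: "abs_continuous_on {a..b} g"
  shows "abs_continuous_on {a..b} (\<lambda>t. f t * g t)"
proof -
  have "bounded (f ` {a..b})" "bounded (g ` {a..b})"
    using f g by (auto intro!: compact_imp_bounded compact_continuous_image abs_continuous_on_imp_continuous_on)
  then obtain M N where MN: "\<And>t. t \<in> {a..b} \<Longrightarrow> norm (f t) \<le> M" "\<And>t. t \<in> {a..b} \<Longrightarrow> norm (g t) \<le> N"
    unfolding bounded_iff by blast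
  show ?thesis
  proof (rule abs_continuous_on_dominated[OF f g])
    fix s t assume st: "s \<in> {a..b}" "t \<in> {a..b}"
    have "f t * g t - f s * g s = (f t - f s) * g t + f s * (g t - g s)" by (simp add: algebra_simps)
    also have "norm \<dots> \<le> norm (f t - f s) * norm (g t) + norm (f s) * norm (g t - g s)"
      by (meson add_mono norm_mult_ineq norm_triangle_ineq order_trans)
    also have "\<dots> \<le> norm (f t - f s) * (max M N) + (max M N) * norm (g t - g s)"
      using MN(2)[OF st(2)] MN(1)[OF st(1)] by (intro add_mono mult_left_mono mult_right_mono) auto
    also have "\<dots> = max M N * (norm (f t - f s) + norm (g t - g s))" by (simp add: algebra_simps)
    finally show "norm (f t * g t - f s * g s) \<le> max M N * (norm (f t - f s) + norm (g t - g s))" .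
  qed
qed

lemma abs_continuous_on_exp:
  fixes f :: "real \<Rightarrow> real"
  assumes f: "abs_continuous_on {a..b} f"
  shows "abs_continuous_on {a..b} (\<lambda>t. exp (f t))"
proof -
  have "bounded (f ` {a..b})"
    using f by (auto intro!: compact_imp_bounded compact_continuous_image abs_continuous_on_imp_continuous_on)
  then obtain M where M: "\<And>t. t \<in> {a..b} \<Longrightarrow> norm (f t) \<le> M" unfolding bounded_iff by blast
  have lip: "\<bar>exp x - exp y\<bar> \<le> exp M * \<bar>x - y\<bar>" if "x \<le> M" "y \<le> M" for x y :: real
  proof -
    have "norm (exp x - exp y) \<le> exp M * norm (x - y)"
    proof (rule field_differentiable_bound[where S="{..M}" and f' = exp])
      show "(exp has_field_derivative exp z) (at z within {..M})" for z :: real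
        by (auto intro!: derivative_eq_intros)
    qed (use that in auto)
    then show ?thesis by simp
  qed
  show ?thesis
  proof (rule abs_continuous_on_dominated[OF f f])
    fix s t assume "s \<in> {a..b}" "t \<in> {a..b}"
    then have "\<bar>exp (f t) - exp (f s)\<bar> \<le> exp M * \<bar>f t - f s\<bar>" using M[of s] M[of t] by (intro lip) auto
    also have "\<dots> \<le> exp M * (\<bar>f t - f s\<bar> + \<bar>f t - f s\<bar>)" by (intro mult_left_mono) auto
    finally show "norm (exp (f t) - exp (f s)) \<le> exp M * (norm (f t - f s) + norm (f t - f s))" by simp
  qed
qed

section \<open>Differentiation of indefinite integrals\<close>

text \<open>Absolute continuity of the integral: up to a remainder \<open>h\<close> of small integral, \<open>norm f\<close> is bounded by
  some \<open>k\<close>, and a bounded function contributes at most \<open>k\<close> times the measure of the set.\<close>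

lemma abs_continuous_on_integral:
  fixes f :: "real \<Rightarrow> 'a::euclidean_space"
  assumes f: "f absolutely_integrable_on {a..b}"
  shows "abs_continuous_on {a..b} (\<lambda>t. integral {a..t} f)"
  unfolding abs_continuous_on_def
proof (intro allI impI)
  fix \<epsilon> :: real assume "\<epsilon> > 0"
  define c where "c k t = min (norm (f t)) (real k)" for k t
  have nf: "(\<lambda>t. norm (f t)) integrable_on {a..b}"
    using f absolutely_integrable_on_def by blast
  have anf: "(\<lambda>t. norm (f t)) absolutely_integrable_on {a..b}"
    using f by (simp add: absolutely_integrable_on_def)
  have c_int: "c k integrable_on {a..b}" for k
  proof -
    have "(\<lambda>t. min (norm (f t)) (real k)) absolutely_integrable_on {a..b}"
      by (intro absolutely_integrable_min_1 anf absolutely_integrable_on_const) auto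
    then have "(\<lambda>t. min (norm (f t)) (real k)) integrable_on {a..b}"
      by (rule set_lebesgue_integral_eq_integral(1))
    moreover have "c k = (\<lambda>t. min (norm (f t)) (real k))" by (simp add: c_def fun_eq_iff)
    ultimately show ?thesis by simp
  qed
  have "(\<lambda>k. integral {a..b} (c k)) \<longlonglongrightarrow> integral {a..b} (\<lambda>t. norm (f t))"
  proof (rule dominated_convergence(2)[OF c_int nf])
    show "norm (c k t) \<le> norm (f t)" for k t by (simp add: c_def)
    show "(\<lambda>k. c k t) \<longlonglongrightarrow> norm (f t)" if "t \<in> {a..b}" for t
    proof (rule tendsto_eventually)
      show "\<forall>\<^sub>F k in sequentially. c k t = norm (f t)"
        using eventually_ge_at_top[of "nat \<lceil>norm (f t)\<rceil>"]
        by eventually_elim (auto simp: c_def min_def nat_ceiling_le_eq)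
    qed
  qed
  then obtain k where k: "norm (integral {a..b} (c k) - integral {a..b} (\<lambda>t. norm (f t))) < \<epsilon>/2"
    using \<open>\<epsilon> > 0\<close> by (metis LIMSEQ_D half_gt_zero order_refl)
  define h where "h t = norm (f t) - c k t" for t
  have h_int: "h integrable_on {a..b}" unfolding h_def using nf c_int by (rule integrable_diff)
  have h_nn: "h t \<ge> 0" for t by (simp add: h_def c_def)
  have h_small: "integral {a..b} h < \<epsilon>/2"
  proof -
    have "integral {a..b} h = integral {a..b} (\<lambda>t. norm (f t)) - integral {a..b} (c k)"
      unfolding h_def[abs_def] by (rule Henstock_Kurzweil_Integration.integral_diff[OF nf c_int])
    then show ?thesis using k by (simp only: real_norm_def)
  qed
  show "\<exists>\<delta>>0. \<forall>d. d division_of \<Union>d \<and> \<Union>d \<subseteq> {a..b} \<and> (\<Sum>K\<in>d. measure lborel K) < \<delta> \<longrightarrow>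
        (\<Sum>K\<in>d. norm (integral {a..Sup K} f - integral {a..Inf K} f)) < \<epsilon>"
  proof (intro exI conjI allI impI)
    show "\<epsilon> / (2 * (real k + 1)) > 0" using \<open>\<epsilon> > 0\<close> by simp
    fix d assume d: "d division_of \<Union>d \<and> \<Union>d \<subseteq> {a..b} \<and> (\<Sum>K\<in>d. measure lborel K) < \<epsilon> / (2 * (real k + 1))"
    then have div: "d division_of \<Union>d" and sub: "\<Union>d \<subseteq> {a..b}" by auto
    have one: "norm (integral {a..Sup K} f - integral {a..Inf K} f) \<le> integral K h + real k * measure lborel K" if Kd: "K \<in> d" for K
    proof -
      obtain u v where K: "K = cbox u v" "K \<noteq> {}"
        using division_ofD(3)[OF div Kd] division_ofD(4)[OF div Kd] by blast
      then have uv: "u \<le> v" by auto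
      have "K \<subseteq> {a..b}" using sub Kd by auto
      then have uab: "a \<le> u" "v \<le> b" using K uv by auto
      have int_av: "f integrable_on {a..v}"
        by (rule integrable_subinterval_real[of f a b]) (use f uab uv in \<open>auto simp: absolutely_integrable_on_def\<close>)
      have "integral {a..u} f + integral {u..v} f = integral {a..v} f"
        by (rule Henstock_Kurzweil_Integration.integral_combine) (use uab uv int_av in auto)
      then have "norm (integral {a..Sup K} f - integral {a..Inf K} f) = norm (integral {u..v} f)"
        using K uv by (simp add: algebra_simps) (metis add_diff_cancel_left')
      also have "\<dots> \<le> integral {u..v} (\<lambda>t. norm (f t))"
      proof (rule Henstock_Kurzweil_Integration.integral_norm_bound_integral)
        show "f integrable_on {u..v}"
          by (rule integrable_subinterval_real[OF int_av]) (use uab in auto)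
        show "(\<lambda>t. norm (f t)) integrable_on {u..v}"
          by (rule integrable_subinterval_real[OF nf]) (use uab in auto)
      qed simp
      also have "\<dots> \<le> integral {u..v} (\<lambda>t. h t + real k)"
      proof (rule integral_le)
        show "(\<lambda>t. norm (f t)) integrable_on {u..v}"
          by (rule integrable_subinterval_real[OF nf]) (use uab in auto)
        show "(\<lambda>t. h t + real k) integrable_on {u..v}"
          by (intro integrable_add integrable_subinterval_real[OF h_int]) (use uab in auto)
        show "norm (f t) \<le> h t + real k" for t by (simp add: h_def c_def)
      qed
      also have "\<dots> = integral {u..v} h + real k * (v - u)"
        using uab uv by (subst Henstock_Kurzweil_Integration.integral_add)
            (auto intro: integrable_subinterval_real[OF h_int])
      finally show ?thesis using K uv by simp
    qed
    have "h integrable_on \<Union>d"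
      by (rule integrable_on_subdivision[OF div h_int sub])
    have "(\<Sum>K\<in>d. norm (integral {a..Sup K} f - integral {a..Inf K} f)) \<le> (\<Sum>K\<in>d. integral K h + real k * measure lborel K)"
      using one by (rule sum_mono)
    also have "\<dots> = (\<Sum>K\<in>d. integral K h) + real k * (\<Sum>K\<in>d. measure lborel K)"
      by (simp add: sum.distrib sum_distrib_left)
    also have "(\<Sum>K\<in>d. integral K h) = integral (\<Union>d) h"
      using integral_combine_division_topdown[OF \<open>h integrable_on \<Union>d\<close> div] by simp
    also have "integral (\<Union>d) h \<le> integral {a..b} h"
      by (rule integral_subset_le) (use sub \<open>h integrable_on \<Union>d\<close> h_int h_nn in auto)
    also have "integral {a..b} h + real k * (\<Sum>K\<in>d. measure lborel K) < \<epsilon>/2 + (real k + 1) * (\<epsilon> / (2 * (real k + 1)))"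
    proof (rule add_less_le_mono[OF h_small])
      have "real k * (\<Sum>K\<in>d. measure lborel K) \<le> (real k + 1) * (\<Sum>K\<in>d. measure lborel K)"
        by (intro mult_right_mono sum_nonneg) auto
      also have "\<dots> \<le> (real k + 1) * (\<epsilon> / (2 * (real k + 1)))"
        using d by (intro mult_left_mono) auto
      finally show "real k * (\<Sum>K\<in>d. measure lborel K) \<le> (real k + 1) * (\<epsilon> / (2 * (real k + 1)))" .
    qed
    also have "\<dots> = \<epsilon>" by (simp add: field_simps)
    finally show "(\<Sum>K\<in>d. norm (integral {a..Sup K} f - integral {a..Inf K} f)) < \<epsilon>" by simp
  qed
qed

text \<open>The core of the Lebesgue differentiation theorem.  By Henstock's lemma, finitely many disjoint fine
  intervals on which the increment of \<open>F\<close> deviates from \<open>f x\<close> times the length by a fraction \<open>e\<close> of the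
  length have small total length.  Such intervals, with an end point as tag, cover the set in
  question, and Vitali's covering lemma makes them disjoint at the price of the factor 5.\<close>

lemma negligible_bad_difference_quotients:
  fixes f :: "real \<Rightarrow> 'a::euclidean_space"
  assumes f: "f integrable_on {a..b}" and "e > 0"
  defines "F \<equiv> \<lambda>t. integral {a..t} f"
  shows "negligible {x\<in>{a..b}. \<forall>\<delta>>0. \<exists>y\<in>{a..b}. \<bar>y-x\<bar> < \<delta> \<and> norm (F y - F x - (y-x) *\<^sub>R f x) > e * \<bar>y-x\<bar>}"
    (is "negligible ?E")
  unfolding negligible_outer_le
proof (intro allI impI)
  fix \<eta> :: real assume "\<eta> > 0"
  define e' where "e' = e * \<eta> / 5"
  have "e' > 0" using \<open>\<eta> > 0\<close> \<open>e > 0\<close> by (simp add: e'_def)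
  have f': "f integrable_on cbox a b" using f by simp
  obtain \<gamma> where \<gamma>: "gauge \<gamma>" "\<And>p. \<lbrakk>p tagged_partial_division_of (cbox a b); \<gamma> fine p\<rbrakk> \<Longrightarrow>
             (\<Sum>(x,k)\<in>p. norm (measure lborel k *\<^sub>R f x - integral k f)) < e'"
    by (rule Henstock_lemma[OF f' \<open>e' > 0\<close>]) (rule that, assumption+)
  define P where "P x y \<longleftrightarrow> y \<in> {a..b} \<and> {min x y..max x y} \<subseteq> \<gamma> x \<and>
    norm (F y - F x - (y-x) *\<^sub>R f x) > e * \<bar>y-x\<bar>" for x y
  have "\<exists>y\<in>{a..b}. {min x y..max x y} \<subseteq> \<gamma> x \<and> norm (F y - F x - (y-x) *\<^sub>R f x) > e * \<bar>y-x\<bar>" if x: "x \<in> ?E" for x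
  proof -
    obtain \<delta> where \<delta>: "\<delta> > 0" "ball x \<delta> \<subseteq> \<gamma> x"
      using \<gamma>(1) unfolding gauge_def by (meson openE)
    obtain y where y: "y\<in>{a..b}" "\<bar>y-x\<bar> < \<delta>" "norm (F y - F x - (y-x) *\<^sub>R f x) > e * \<bar>y-x\<bar>"
      using x \<delta>(1) by blast
    have "{min x y..max x y} \<subseteq> ball x \<delta>" using y(2) by (auto simp: dist_real_def)
    then show ?thesis using y \<delta>(2) by blast
  qed
  then have "\<forall>x\<in>?E. \<exists>y. P x y" unfolding P_def by blast
  from bchoice[OF this] obtain Y where YP: "\<forall>x\<in>?E. P x (Y x)" by (elim exE)
  have Y: "Y x \<in> {a..b}" "{min x (Y x)..max x (Y x)} \<subseteq> \<gamma> x"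
    "norm (F (Y x) - F x - (Y x-x) *\<^sub>R f x) > e * \<bar>Y x-x\<bar>" if "x \<in> ?E" for x
    using bspec[OF YP that] by (auto simp only: P_def)
  have Yne: "Y x \<noteq> x" if "x \<in> ?E" for x using Y(3)[OF that] by auto
  define m where "m x = (x + Y x) / 2" for x
  define r where "r x = \<bar>Y x - x\<bar> / 2" for x
  have cb: "cball (m x) (r x) = {min x (Y x)..max x (Y x)}" for x
    by (auto simp: cball_eq_atLeastAtMost m_def r_def min_def max_def field_simps)
  have "?E \<subseteq> (\<Union>x\<in>?E. cball (m x) (r x))" unfolding cb by auto
  moreover have "0 < r x \<and> r x \<le> b - a" if "x \<in> ?E" for x
    using Yne[OF that] Y(1)[OF that] that by (auto simp: r_def)
  ultimately obtain C where C: "countable C" "C \<subseteq> ?E"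
     "pairwise (\<lambda>i j. disjnt (cball (m i) (r i)) (cball (m j) (r j))) C"
     "?E \<subseteq> (\<Union>i\<in>C. cball (m i) (5 * r i))"
    by (rule Vitali_covering_lemma_cballs)
  have fin: "(\<Sum>x\<in>D. 2 * r x) \<le> e' / e" if D: "D \<subseteq> C" "finite D" for D
  proof -
    define p where "p = (\<lambda>x. (x, cball (m x) (r x))) ` D"
    have DE: "x \<in> ?E" if "x \<in> D" for x using that D C by blast
    have part: "p tagged_partial_division_of (cbox a b)"
      unfolding tagged_partial_division_of_def
    proof (intro conjI allI impI)
      show "finite p" using D by (simp add: p_def)
      fix x K assume "(x,K) \<in> p"
      then have K: "K = cball (m x) (r x)" "x \<in> D" by (auto simp: p_def)
      show "x \<in> K" unfolding K cb by auto
      show "K \<subseteq> cbox a b" unfolding K cb using DE[OF K(2)] Y(1)[OF DE[OF K(2)]] by auto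
      show "\<exists>u v. K = cbox u v" unfolding K cb by (metis box_real(2))
    next
      fix x1 K1 x2 K2 assume *: "(x1,K1) \<in> p \<and> (x2,K2) \<in> p \<and> (x1,K1) \<noteq> (x2,K2)"
      then have "x1 \<noteq> x2" "x1 \<in> C" "x2 \<in> C" and K: "K1 = cball (m x1) (r x1)" "K2 = cball (m x2) (r x2)"
        using D by (auto simp: p_def)
      then have "disjnt K1 K2" unfolding K using pairwiseD[OF C(3)] by blast
      then show "interior K1 \<inter> interior K2 = {}"
        using interior_subset by (fastforce simp: disjnt_def)
    qed
    have fine: "\<gamma> fine p" using Y(2)[OF DE] by (auto simp: fine_def p_def cb)
    have "e * (\<Sum>x\<in>D. 2 * r x) \<le> (\<Sum>x\<in>D. norm (measure lborel (cball (m x) (r x)) *\<^sub>R f x - integral (cball (m x) (r x)) f))"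
      unfolding sum_distrib_left
    proof (rule sum_mono)
      fix x assume "x \<in> D"
      then have xE: "x \<in> ?E" by (rule DE)
      have sub: "f integrable_on {a..t}" if "t \<in> {a..b}" for t
        by (rule integrable_subinterval_real[OF f]) (use that in auto)
      have comb: "integral {s..t} f = F t - F s" if "a \<le> s" "s \<le> t" "t \<le> b" for s t
        using Henstock_Kurzweil_Integration.integral_combine[OF that(1,2) sub] that
        by (simp add: F_def algebra_simps)
      have "norm (measure lborel (cball (m x) (r x)) *\<^sub>R f x - integral (cball (m x) (r x)) f)
         = norm (F (Y x) - F x - (Y x-x) *\<^sub>R f x)"
      proof (cases "x \<le> Y x")
        case True
        then have "measure lborel (cball (m x) (r x)) *\<^sub>R f x - integral (cball (m x) (r x)) f
          = - (F (Y x) - F x - (Y x-x) *\<^sub>R f x)"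
          unfolding cb using comb[of x "Y x"] xE Y(1)[OF xE] by simp
        then show ?thesis by (simp only: norm_minus_cancel)
      next
        case False
        then have "measure lborel (cball (m x) (r x)) *\<^sub>R f x - integral (cball (m x) (r x)) f
          = F (Y x) - F x - (Y x-x) *\<^sub>R f x"
          unfolding cb using comb[of "Y x" x] xE Y(1)[OF xE] by (simp add: algebra_simps)
        then show ?thesis by simp
      qed
      then show "e * (2 * r x) \<le> norm (measure lborel (cball (m x) (r x)) *\<^sub>R f x - integral (cball (m x) (r x)) f)"
        using Y(3)[OF xE] by (simp add: r_def)
    qed
    also have "\<dots> = (\<Sum>(x,k)\<in>p. norm (measure lborel k *\<^sub>R f x - integral k f))"
      unfolding p_def by (subst sum.reindex) (auto simp: inj_on_def)
    also have "\<dots> < e'" by (rule \<gamma>(2)[OF part fine])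
    finally show ?thesis using \<open>e > 0\<close> by (simp add: field_simps)
  qed
  have le: "measure lebesgue (\<Union>x\<in>D. cball (m x) (5 * r x)) \<le> \<eta>" if D: "D \<subseteq> C" "finite D" for D
  proof -
    have "measure lebesgue (\<Union>x\<in>D. cball (m x) (5 * r x)) \<le> (\<Sum>x\<in>D. measure lebesgue (cball (m x) (5 * r x)))"
      by (rule measure_UNION_le) (use D in auto)
    also have "\<dots> = 5 * (\<Sum>x\<in>D. 2 * r x)"
      by (simp add: sum_distrib_left cball_eq_atLeastAtMost r_def)
    also have "\<dots> \<le> 5 * (e' / e)" using fin[OF D] by simp
    also have "\<dots> = \<eta>" using \<open>e > 0\<close> by (simp add: e'_def)
    finally show ?thesis .
  qed
  show "\<exists>T. ?E \<subseteq> T \<and> T \<in> lmeasurable \<and> measure lebesgue T \<le> \<eta>"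
  proof (intro exI conjI)
    show "?E \<subseteq> (\<Union>i\<in>C. cball (m i) (5 * r i))" by (rule C(4))
    show "(\<Union>i\<in>C. cball (m i) (5 * r i)) \<in> lmeasurable"
      by (rule fmeasurable_UN_bound[OF C(1) _ le]) auto
    show "measure lebesgue (\<Union>i\<in>C. cball (m i) (5 * r i)) \<le> \<eta>"
      by (rule measure_UN_bound[OF C(1) _ le]) auto
  qed
qed

lemma AE_has_vector_derivative_integral:
  fixes f :: "real \<Rightarrow> 'a::euclidean_space"
  assumes f: "f integrable_on {a..b}"
  shows "AE t in lebesgue. t \<in> {a..b} \<longrightarrow>
           ((\<lambda>s. integral {a..s} f) has_vector_derivative f t) (at t within {a..b})"
proof -
  define F where "F = (\<lambda>t. integral {a..t} f)"
  define E where "E e = {x\<in>{a..b}. \<forall>\<delta>>0. \<exists>y\<in>{a..b}. \<bar>y-x\<bar> < \<delta> \<and> norm (F y - F x - (y-x) *\<^sub>R f x) > e * \<bar>y-x\<bar>}" for e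
  have "negligible (E (inverse (real (Suc k))))" for k
    unfolding E_def F_def by (rule negligible_bad_difference_quotients[OF f]) simp
  then have "negligible (\<Union>k. E (inverse (real (Suc k))))"
    by (intro negligible_countable_Union) auto
  moreover have "{t. \<not> (t \<in> {a..b} \<longrightarrow> (F has_vector_derivative f t) (at t within {a..b}))} \<subseteq> (\<Union>k. E (inverse (real (Suc k))))"
  proof (clarsimp simp only: subset_iff mem_Collect_eq not_imp)
    fix t assume t: "t \<in> {a..b}" "\<not> (F has_vector_derivative f t) (at t within {a..b})"
    show "t \<in> (\<Union>k. E (inverse (real (Suc k))))"
    proof (rule ccontr)
      assume out: "t \<notin> (\<Union>k. E (inverse (real (Suc k))))"
      have "(F has_vector_derivative f t) (at t within {a..b})"
        unfolding has_vector_derivative_def has_derivative_within_alt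
      proof (intro conjI allI impI)
        show "bounded_linear (\<lambda>h. h *\<^sub>R f t)" by (rule bounded_linear_scaleR_left)
        fix e :: real assume "e > 0"
        then obtain k where k: "inverse (real (Suc k)) < e" using reals_Archimedean by blast
        obtain \<delta> where \<delta>: "\<delta> > 0" "\<And>y. y\<in>{a..b} \<Longrightarrow> \<bar>y-t\<bar> < \<delta> \<Longrightarrow> norm (F y - F t - (y-t) *\<^sub>R f t) \<le> inverse (real (Suc k)) * \<bar>y-t\<bar>"
        proof -
          have "t \<notin> E (inverse (real (Suc k)))" using out by blast
          then show ?thesis using t(1) that unfolding E_def mem_Collect_eq by (meson not_le)
        qed
        have "norm (F y - F t - (y-t) *\<^sub>R f t) \<le> e * norm (y-t)" if "y\<in>{a..b}" "norm (y-t) < \<delta>" for y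
          using \<delta>(2)[of y] that k by (smt (verit) mult_right_mono real_norm_def abs_ge_zero)
        then show "\<exists>d>0. \<forall>y\<in>{a..b}. norm (y-t) < d \<longrightarrow> norm (F y - F t - (y-t) *\<^sub>R f t) \<le> e * norm (y-t)"
          using \<delta>(1) by blast
      qed
      with t(2) show False by simp
    qed
  qed
  ultimately show ?thesis unfolding eventually_ae_filter_negligible F_def by blast
qed

section \<open>Locally integrable functions\<close>

lemma locally_integrableD: "locally_integrable f \<Longrightarrow> f integrable_on {a..b}"
  unfolding locally_integrable_def by (blast intro: set_lebesgue_integral_eq_integral(1))

lemma locally_integrable_add:
  "locally_integrable f \<Longrightarrow> locally_integrable g \<Longrightarrow> locally_integrable (\<lambda>t. f t + g t)"
  unfolding locally_integrable_def by (blast intro: set_integral_add(1))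

lemma locally_integrable_sum:
  fixes f :: "'b \<Rightarrow> real \<Rightarrow> 'a::euclidean_space"
  assumes "finite I" "\<And>i. i \<in> I \<Longrightarrow> locally_integrable (f i)"
  shows "locally_integrable (\<lambda>t. \<Sum>i\<in>I. f i t)"
  unfolding locally_integrable_def
proof (intro allI absolutely_integrable_sum[OF assms(1)])
  show "f i absolutely_integrable_on {a..b}" if "i \<in> I" for i a b
    using assms(2)[OF that] by (simp add: locally_integrable_def)
qed

lemma locally_integrable_norm:
  "locally_integrable f \<Longrightarrow> locally_integrable (\<lambda>t. norm (f t))"
  unfolding locally_integrable_def by (simp add: absolutely_integrable_on_def)

lemma locally_integrable_mult:
  fixes f g :: "real \<Rightarrow> 'a::{real_normed_field, euclidean_space}"
  assumes f: "locally_integrable f" and g: "g \<in> borel_measurable lebesgue" "\<And>a b. bounded (g ` {a..b})"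
  shows "locally_integrable (\<lambda>t. f t * g t)"
  unfolding locally_integrable_def
proof (intro allI)
  fix a b :: real
  have "bilinear ((*) :: 'a \<Rightarrow> 'a \<Rightarrow> 'a)"
    by (simp add: bilinear_conv_bounded_bilinear bounded_bilinear_mult)
  then have "(\<lambda>t. g t * f t) absolutely_integrable_on {a..b}"
    by (rule absolutely_integrable_bounded_measurable_product[where f = g and g = f])
      (use f g in \<open>simp_all add: locally_integrable_def measurable_restrict_space1\<close>)
  then show "(\<lambda>t. f t * g t) absolutely_integrable_on {a..b}" by (simp add: mult.commute)
qed

lemma locally_integrable_mult_continuous:
  fixes f g :: "real \<Rightarrow> 'a::{real_normed_field, euclidean_space}"
  assumes f: "locally_integrable f" and g: "continuous_on UNIV g"
  shows "locally_integrable (\<lambda>t. f t * g t)"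
proof (rule locally_integrable_mult[OF f])
  show "g \<in> borel_measurable lebesgue"
    using borel_measurable_continuous_onI[OF g] by (simp add: measurable_completion)
  show "bounded (g ` {a..b})" for a b
    by (intro compact_imp_bounded compact_continuous_image continuous_on_subset[OF g]) auto
qed

lemma locally_integrable_reflect:
  fixes f :: "real \<Rightarrow> 'a::euclidean_space"
  assumes "locally_integrable f"
  shows "locally_integrable (\<lambda>t. f (- t))"
  unfolding locally_integrable_def
proof (intro allI)
  fix a b :: real
  show "(\<lambda>t. f (- t)) absolutely_integrable_on {a..b}"
    using assms absolutely_integrable_reflect_real[where f = f and a = "-b" and b = "-a"] by (simp add: locally_integrable_def)
qed

lemma continuous_on_integral_locally_integrable:
  fixes f :: "real \<Rightarrow> 'a::euclidean_space"
  assumes f: "locally_integrable f"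
  shows "continuous_on UNIV (\<lambda>t. integral {\<tau>..t} f)"
proof -
  have "continuous_on {\<tau>..} (\<lambda>t. integral {\<tau>..t} f)"
    unfolding continuous_on_eq_continuous_within
  proof
    fix t assume t: "t \<in> {\<tau>..}"
    have "continuous_on {\<tau>..t+1} (\<lambda>t. integral {\<tau>..t} f)"
      by (rule indefinite_integral_continuous_1[OF locally_integrableD[OF f]])
    then have "continuous (at t within {\<tau>..t+1}) (\<lambda>t. integral {\<tau>..t} f)"
      using t by (simp add: continuous_on_eq_continuous_within)
    moreover have "at t within {\<tau>..t+1} = at t within {\<tau>..}"
      by (rule at_within_nhd[of t "{..<t+1}"]) auto
    ultimately show "continuous (at t within {\<tau>..}) (\<lambda>t. integral {\<tau>..t} f)" by simp
  qed
  then have "continuous_on UNIV (\<lambda>t. integral {\<tau>..max \<tau> t} f)"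
    by (rule continuous_on_compose2) (auto intro!: continuous_intros)
  moreover have "integral {\<tau>..max \<tau> t} f = integral {\<tau>..t} f" for t
    by (cases "\<tau> \<le> t") (auto simp: max_def)
  ultimately show ?thesis by simp
qed

lemma primitive_abs_continuous_on:
  fixes f :: "real \<Rightarrow> 'a::euclidean_space"
  assumes f: "locally_integrable f" and F: "\<And>t. t \<in> {a..b} \<Longrightarrow> F t = c + integral {a..t} f"
  shows "abs_continuous_on {a..b} F"
proof (rule abs_continuous_on_dominated[OF abs_continuous_on_integral abs_continuous_on_const])
  show "f absolutely_integrable_on {a..b}" using f by (simp add: locally_integrable_def)
  show "norm (F t - F s) \<le> 1 * (norm (integral {a..t} f - integral {a..s} f) + norm (c - c))"
    if "s \<in> {a..b}" "t \<in> {a..b}" for s t using that F by simp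
qed

lemma primitive_has_vector_derivative:
  fixes f :: "real \<Rightarrow> 'a::euclidean_space"
  assumes f: "locally_integrable f" and F: "\<And>t. t \<in> {a..b} \<Longrightarrow> F t = c + integral {a..t} f"
  shows "AE t in lebesgue. t \<in> {a..b} \<longrightarrow> (F has_vector_derivative f t) (at t within {a..b})"
  using AE_has_vector_derivative_integral[OF locally_integrableD[OF f], of a b]
proof eventually_elim
  case (elim t)
  show ?case
  proof
    assume t: "t \<in> {a..b}"
    have "((\<lambda>t. c + integral {a..t} f) has_vector_derivative f t) (at t within {a..b})"
      using elim t by (auto intro!: derivative_eq_intros)
    then show "(F has_vector_derivative f t) (at t within {a..b})"
      by (rule has_vector_derivative_transform[OF t, rotated]) (use F in auto)
  qed
qed

text \<open>For a locally integrable \<open>w\<close> with primitive \<open>\<alpha>\<close>, the chain rule for \<open>exp (2 \<alpha>)\<close> holds almost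
  everywhere, which is enough because \<open>exp (2 \<alpha>)\<close> is absolutely continuous.\<close>

lemma has_integral_weight_exp:
  fixes w :: "real \<Rightarrow> real"
  assumes w: "locally_integrable w" and "\<tau> \<le> t"
  defines "\<alpha> \<equiv> \<lambda>t. integral {\<tau>..t} w"
  shows "((\<lambda>s. w s * exp (2 * \<alpha> s)) has_integral (exp (2 * \<alpha> t) - 1) / 2) {\<tau>..t}"
proof -
  have ac: "abs_continuous_on {\<tau>..t} \<alpha>"
    by (rule primitive_abs_continuous_on[OF w, of _ _ _ 0]) (simp add: \<alpha>_def)
  have der: "AE s in lebesgue. s \<in> {\<tau>..t} \<longrightarrow> (\<alpha> has_vector_derivative w s) (at s within {\<tau>..t})"
    by (rule primitive_has_vector_derivative[OF w, of _ _ _ 0]) (simp add: \<alpha>_def)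
  have "((\<lambda>s. 2 * w s * exp (2 * \<alpha> s)) has_integral (exp (2 * \<alpha> t) - exp (2 * \<alpha> \<tau>))) {\<tau>..t}"
  proof (rule abs_continuous_on_has_integral[OF \<open>\<tau> \<le> t\<close>])
    show "abs_continuous_on {\<tau>..t} (\<lambda>s. exp (2 * \<alpha> s))"
      by (intro abs_continuous_on_exp abs_continuous_on_mult abs_continuous_on_const ac)
    show "AE s in lebesgue. s \<in> {\<tau>..t} \<longrightarrow>
       ((\<lambda>s. exp (2 * \<alpha> s)) has_vector_derivative 2 * w s * exp (2 * \<alpha> s)) (at s within {\<tau>..t})"
      using der
    proof eventually_elim
      case (elim s)
      show ?case
      proof
        assume "s \<in> {\<tau>..t}"
        with elim have "(\<alpha> has_field_derivative w s) (at s within {\<tau>..t})"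
          by (simp add: has_real_derivative_iff_has_vector_derivative)
        then have "((\<lambda>s. exp (2 * \<alpha> s)) has_field_derivative 2 * w s * exp (2 * \<alpha> s)) (at s within {\<tau>..t})"
          by (auto intro!: derivative_eq_intros)
        then show "((\<lambda>s. exp (2 * \<alpha> s)) has_vector_derivative 2 * w s * exp (2 * \<alpha> s)) (at s within {\<tau>..t})"
          by (simp add: has_real_derivative_iff_has_vector_derivative)
      qed
    qed
  qed
  then have "((\<lambda>s. (1/2) * (2 * w s * exp (2 * \<alpha> s))) has_integral (1/2) * (exp (2 * \<alpha> t) - exp (2 * \<alpha> \<tau>))) {\<tau>..t}"
    by (rule has_integral_mult_right)
  then show ?thesis by (simp add: \<alpha>_def)
qed

section \<open>Linear differential equations with locally integrable coefficients\<close>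

text \<open>This makes continuity on the index-time domain a matter of the single components.\<close>

lemma continuous_on_discrete_times:
  fixes f :: "'b discrete \<times> real \<Rightarrow> 'a::topological_space"
  assumes "\<And>i. continuous_on UNIV (\<lambda>t. f (i, t))"
  shows "continuous_on UNIV f"
proof -
  have "continuous_on (\<Union>i\<in>UNIV. {i} \<times> UNIV) f"
  proof (rule continuous_on_open_UN)
    show "open ({i} \<times> (UNIV :: real set))" for i :: "'b discrete"
      by (intro open_Times Discrete_Topology.open_discrete open_UNIV)
    show "continuous_on ({i} \<times> UNIV) f" for i
    proof (rule continuous_on_eq)
      show "continuous_on ({i} \<times> UNIV) (\<lambda>p. f (i, snd p))"
        by (rule continuous_on_compose2[OF assms]) (auto intro!: continuous_intros)
    qed auto
  qed
  moreover have "(\<Union>i::'b discrete\<in>UNIV. {i} \<times> (UNIV :: real set)) = UNIV" by auto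
  ultimately show ?thesis by simp
qed

text \<open>The initial value problem \<open>x' = a x + b\<close>, \<open>x(\<tau>) = c\<close>.  Picard iteration is carried out for
  \<open>g = x / weight\<close> in the Banach space of bounded continuous functions.  The weight grows so fast,
  \<open>weight' = 2 * coeff_size * weight\<close> almost everywhere, that the integral operator becomes a contraction with factor \<open>1/2\<close>
  and that the solution exists on the whole half-line at once.  The dimension \<open>n\<close> being a number and
  not a type, a vector function is encoded as a scalar function of a discrete index and of time; components
  with index at least \<open>n\<close> are 0.\<close>

locale linear_ode =
  fixes n :: nat and a :: "nat \<Rightarrow> nat \<Rightarrow> real \<Rightarrow> 'a::{real_normed_field, euclidean_space}"
    and b :: "nat \<Rightarrow> real \<Rightarrow> 'a" and \<tau> :: real and c :: "nat \<Rightarrow> 'a"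
  assumes a: "\<And>i j. i < n \<Longrightarrow> j < n \<Longrightarrow> locally_integrable (a i j)"
    and b: "\<And>i. i < n \<Longrightarrow> locally_integrable (b i)"
begin

definition coeff_size :: "real \<Rightarrow> real" where
  "coeff_size s = (\<Sum>i<n. \<Sum>j<n. norm (a i j s)) + (\<Sum>i<n. norm (b i s))"

definition weight :: "real \<Rightarrow> real" where
  "weight t = exp (2 * integral {\<tau>..t} coeff_size)"

definition rhs :: "(nat discrete \<times> real \<Rightarrow> 'a) \<Rightarrow> nat \<Rightarrow> real \<Rightarrow> 'a" where
  "rhs g i s = (\<Sum>j<n. a i j s * (weight s *\<^sub>R g (discrete j, s))) + b i s"

definition picard :: "(nat discrete \<times> real \<Rightarrow> 'a) \<Rightarrow> nat discrete \<times> real \<Rightarrow> 'a" where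
  "picard g = (\<lambda>(k, t). let i = of_discrete k in
     if i < n then (c i + integral {\<tau>..t} (rhs g i)) /\<^sub>R weight t else 0)"

lemma locally_integrable_coeff_size: "locally_integrable coeff_size"
  unfolding coeff_size_def[abs_def]
  by (intro locally_integrable_add locally_integrable_sum locally_integrable_norm a b) auto

lemma coeff_size_nonneg: "0 \<le> coeff_size s"
  by (simp add: coeff_size_def sum_nonneg)

lemma weight_ge_1: "1 \<le> weight t"
  using coeff_size_nonneg by (simp add: weight_def Henstock_Kurzweil_Integration.integral_nonneg[OF locally_integrableD[OF locally_integrable_coeff_size]])

lemma weight_pos: "0 < weight t"
  by (simp add: weight_def)

lemma continuous_on_weight: "continuous_on S weight"
  unfolding weight_def[abs_def]
  by (intro continuous_intros continuous_on_subset[OF continuous_on_integral_locally_integrable[OF locally_integrable_coeff_size]]) auto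

lemma has_integral_coeff_size_weight:
  "\<tau> \<le> t \<Longrightarrow> ((\<lambda>s. coeff_size s * weight s) has_integral (weight t - 1) / 2) {\<tau>..t}"
  unfolding weight_def using has_integral_weight_exp[OF locally_integrable_coeff_size] by simp

lemma rhs_integrable:
  assumes "i < n" and g: "\<And>j. j < n \<Longrightarrow> continuous_on UNIV (\<lambda>t. g (discrete j, t))"
  shows "locally_integrable (rhs g i)"
  unfolding rhs_def[abs_def]
  by (intro locally_integrable_add locally_integrable_sum locally_integrable_mult_continuous a b
      continuous_intros continuous_on_weight g) (use assms(1) in auto)

text \<open>The source of the contraction factor: \<open>coeff_size * weight\<close> integrates to at most \<open>weight / 2\<close>.\<close>

lemma norm_integral_le_weight:
  assumes h: "locally_integrable h" and le: "\<And>s. s \<ge> \<tau> \<Longrightarrow> norm (h s) \<le> M * (coeff_size s * weight s)" and "M \<ge> 0"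
  shows "norm (integral {\<tau>..t} h /\<^sub>R weight t) \<le> M / 2"
proof (cases "\<tau> \<le> t")
  case True
  have M: "((\<lambda>s. M * (coeff_size s * weight s)) has_integral M * ((weight t - 1) / 2)) {\<tau>..t}"
    by (intro has_integral_mult_right has_integral_coeff_size_weight True)
  have "norm (integral {\<tau>..t} h) \<le> integral {\<tau>..t} (\<lambda>s. M * (coeff_size s * weight s))"
    by (rule Henstock_Kurzweil_Integration.integral_norm_bound_integral)
       (use le M locally_integrableD[OF h] in \<open>auto simp: integrable_on_def\<close>)
  also have "\<dots> = M * ((weight t - 1) / 2)" using M by (rule integral_unique)
  also have "\<dots> \<le> M / 2 * weight t" using \<open>M \<ge> 0\<close> by (simp add: field_simps)
  finally show ?thesis using weight_pos[of t] by (simp add: field_simps)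
qed (use \<open>M \<ge> 0\<close> in simp)

lemma norm_sum_a_le:
  assumes "i < n" and "\<And>j. j < n \<Longrightarrow> norm (y j) \<le> B"
  shows "norm (\<Sum>j<n. a i j s * (weight s *\<^sub>R y j)) \<le> (\<Sum>j<n. norm (a i j s)) * weight s * B"
proof -
  have "norm (\<Sum>j<n. a i j s * (weight s *\<^sub>R y j)) \<le> (\<Sum>j<n. norm (a i j s) * (weight s * B))"
  proof (rule sum_norm_le)
    fix j assume "j \<in> {..<n}"
    then show "norm (a i j s * (weight s *\<^sub>R y j)) \<le> norm (a i j s) * (weight s * B)"
      using assms(2)[of j] weight_pos[of s] by (auto simp: norm_mult intro!: mult_left_mono)
  qed
  then show ?thesis by (simp add: sum_distrib_right mult.assoc)
qed

lemma sum_a_le_coeff_size: "i < n \<Longrightarrow> (\<Sum>j<n. norm (a i j s)) \<le> coeff_size s"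
  using member_le_sum[of i "{..<n}" "\<lambda>i. \<Sum>j<n. norm (a i j s)"]
  by (auto simp: coeff_size_def sum_nonneg intro: add_increasing2)

text \<open>The inhomogeneity is part of \<open>coeff_size\<close>, so that its integral, too, is dominated by the weight.\<close>

lemma sum_a_b_le_coeff_size: "i < n \<Longrightarrow> (\<Sum>j<n. norm (a i j s)) + norm (b i s) \<le> coeff_size s"
  unfolding coeff_size_def
  by (intro add_mono member_le_sum[of i "{..<n}" "\<lambda>i. \<Sum>j<n. norm (a i j s)"]
     member_le_sum[of i "{..<n}" "\<lambda>i. norm (b i s)"]) (auto simp: sum_nonneg)

lemma continuous_section: "continuous_on S (\<lambda>t. apply_bcontfun g (i::nat discrete, t::real))"
  by (rule continuous_on_compose2[OF continuous_on_apply_bcontfun[of UNIV]]) (auto intro!: continuous_intros)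

lemma picard_bcontfun: "picard (apply_bcontfun g) \<in> bcontfun"
proof (rule bcontfun_normI)
  show "continuous_on UNIV (picard (apply_bcontfun g))"
  proof (rule continuous_on_discrete_times)
    fix k :: "nat discrete"
    obtain i where k: "k = discrete i" by (metis of_discrete_inverse)
    show "continuous_on UNIV (\<lambda>t. picard (apply_bcontfun g) (k, t))"
    proof (cases "i < n")
      case True
      then have "locally_integrable (rhs (apply_bcontfun g) i)"
        by (rule rhs_integrable) (rule continuous_section)
      then have "continuous_on UNIV (\<lambda>t. (c i + integral {\<tau>..t} (rhs (apply_bcontfun g) i)) /\<^sub>R weight t)"
        using weight_pos by (intro continuous_intros continuous_on_integral_locally_integrable continuous_on_weight)
          (auto simp: less_imp_neq[symmetric])
      then show ?thesis using True by (simp add: picard_def k discrete_inverse)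
    qed (simp add: picard_def k discrete_inverse)
  qed
next
  fix it :: "nat discrete \<times> real"
  obtain i t where it: "it = (discrete i, t)" by (metis of_discrete_inverse surj_pair)
  show "norm (picard (apply_bcontfun g) it) \<le> (\<Sum>i<n. norm (c i)) + (norm g + 1) / 2"
  proof (cases "i < n")
    case True
    have "norm (c i /\<^sub>R weight t) \<le> norm (c i)"
      using weight_ge_1[of t] weight_pos[of t] mult_left_mono[of 1 "weight t" "norm (c i)"]
      by (simp add: field_simps)
    also have "\<dots> \<le> (\<Sum>i<n. norm (c i))" using True by (intro member_le_sum) auto
    finally have 1: "norm (c i /\<^sub>R weight t) \<le> (\<Sum>i<n. norm (c i))" .
    have 2: "norm (integral {\<tau>..t} (rhs (apply_bcontfun g) i) /\<^sub>R weight t) \<le> (norm g + 1) / 2"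
    proof (rule norm_integral_le_weight)
      show "locally_integrable (rhs (apply_bcontfun g) i)"
        by (rule rhs_integrable[OF True continuous_section])
      fix s
      have "norm (rhs (apply_bcontfun g) i s) \<le> (\<Sum>j<n. norm (a i j s)) * weight s * norm g + norm (b i s)"
        unfolding rhs_def by (intro norm_triangle_le add_mono norm_sum_a_le True norm_bounded order_refl)
      also have "\<dots> \<le> (\<Sum>j<n. norm (a i j s)) * weight s * (norm g + 1) + norm (b i s) * (weight s * (norm g + 1))"
      proof (rule add_mono)
        show "(\<Sum>j<n. norm (a i j s)) * weight s * norm g \<le> (\<Sum>j<n. norm (a i j s)) * weight s * (norm g + 1)"
          using weight_pos[of s] by (intro mult_left_mono mult_nonneg_nonneg sum_nonneg) auto
        have "1 * 1 \<le> weight s * (norm g + 1)"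
          by (rule mult_mono[OF weight_ge_1]) (use weight_pos[of s] in auto)
        then show "norm (b i s) \<le> norm (b i s) * (weight s * (norm g + 1))"
          using mult_left_mono[of 1 "weight s * (norm g + 1)" "norm (b i s)"] by simp
      qed
      also have "\<dots> = ((\<Sum>j<n. norm (a i j s)) + norm (b i s)) * (weight s * (norm g + 1))"
        by (simp add: algebra_simps)
      also have "\<dots> \<le> coeff_size s * (weight s * (norm g + 1))"
        using weight_pos[of s] by (intro mult_right_mono sum_a_b_le_coeff_size True) auto
      finally show "norm (rhs (apply_bcontfun g) i s) \<le> (norm g + 1) * (coeff_size s * weight s)"
        by (simp add: mult_ac)
    qed simp
    show ?thesis
      using norm_triangle_le[OF add_mono[OF 1 2]] True by (simp add: it picard_def discrete_inverse scaleR_add_right)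
  next
    case False
    then show ?thesis by (simp add: it picard_def discrete_inverse sum_nonneg add_nonneg_nonneg)
  qed
qed

lemma picard_contraction:
  "dist (Bcontfun (picard (apply_bcontfun g))) (Bcontfun (picard (apply_bcontfun h))) \<le> 1/2 * dist g h"
proof (rule dist_bound)
  fix it :: "nat discrete \<times> real"
  obtain i t where it: "it = (discrete i, t)" by (metis of_discrete_inverse surj_pair)
  let ?d = "\<lambda>s. rhs (apply_bcontfun g) i s - rhs (apply_bcontfun h) i s"
  have "dist (picard (apply_bcontfun g) it) (picard (apply_bcontfun h) it) \<le> dist g h / 2"
  proof (cases "i < n")
    case True
    have g: "locally_integrable (rhs (apply_bcontfun g) i)" and h: "locally_integrable (rhs (apply_bcontfun h) i)"
      by (rule rhs_integrable[OF True continuous_section])+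
    have d: "?d s = (\<Sum>j<n. a i j s * (weight s *\<^sub>R (apply_bcontfun g (discrete j, s) - apply_bcontfun h (discrete j, s))))" for s
      by (simp add: rhs_def sum_subtractf[symmetric] algebra_simps)
    have "norm (integral {\<tau>..t} ?d /\<^sub>R weight t) \<le> dist g h / 2"
    proof (rule norm_integral_le_weight)
      show "locally_integrable ?d"
        using g h unfolding locally_integrable_def by (blast intro: set_integral_diff(1))
      fix s
      have "norm (?d s) \<le> (\<Sum>j<n. norm (a i j s)) * weight s * dist g h"
        unfolding d by (intro norm_sum_a_le True) (metis dist_bounded dist_norm)
      also have "\<dots> \<le> coeff_size s * weight s * dist g h"
        using weight_pos[of s] by (intro mult_right_mono sum_a_le_coeff_size True) auto
      finally show "norm (?d s) \<le> dist g h * (coeff_size s * weight s)" by (simp add: mult_ac)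
    qed simp
    moreover have "integral {\<tau>..t} ?d = integral {\<tau>..t} (rhs (apply_bcontfun g) i) - integral {\<tau>..t} (rhs (apply_bcontfun h) i)"
      by (intro Henstock_Kurzweil_Integration.integral_diff locally_integrableD g h)
    ultimately show ?thesis
      using True by (simp add: it picard_def discrete_inverse dist_norm scaleR_diff_right[symmetric])
  qed (simp add: it picard_def discrete_inverse)
  then show "dist (apply_bcontfun (Bcontfun (picard (apply_bcontfun g))) it)
       (apply_bcontfun (Bcontfun (picard (apply_bcontfun h))) it) \<le> 1/2 * dist g h"
    by (simp add: Bcontfun_inverse[OF picard_bcontfun])
qed

text \<open>For \<open>t < \<tau>\<close> the interval of integration is empty, and the solution is constant there.\<close>

lemma solution_exists:
  "\<exists>x. \<forall>i<n. continuous_on UNIV (x i) \<and>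
     (\<forall>t. x i t = c i + integral {\<tau>..t} (\<lambda>s. (\<Sum>j<n. a i j s * x j s) + b i s))"
proof -
  let ?T = "\<lambda>g. Bcontfun (picard (apply_bcontfun g))"
  obtain g where g: "?T g = g"
    using banach_fix_type[of "1/2" ?T] picard_contraction by auto
  have fixpoint: "apply_bcontfun g (discrete i, t) = (c i + integral {\<tau>..t} (rhs (apply_bcontfun g) i)) /\<^sub>R weight t" if "i < n" for i t
  proof -
    have "apply_bcontfun g = picard (apply_bcontfun g)"
      using g Bcontfun_inverse[OF picard_bcontfun] by metis
    then have "apply_bcontfun g (discrete i, t) = picard (apply_bcontfun g) (discrete i, t)" by (rule fun_cong)
    then show ?thesis using that by (simp add: picard_def discrete_inverse)
  qed
  define x where "x i t = weight t *\<^sub>R apply_bcontfun g (discrete i, t)" for i t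
  have "x i t = c i + integral {\<tau>..t} (\<lambda>s. (\<Sum>j<n. a i j s * x j s) + b i s)" if "i < n" for i t
    using fixpoint[OF that, of t] weight_pos[of t] by (simp add: x_def rhs_def[abs_def])
  moreover have "continuous_on UNIV (x i)" for i
    unfolding x_def[abs_def] by (intro continuous_intros continuous_on_weight continuous_section)
  ultimately show ?thesis by blast
qed

end

section \<open>Duality of controllability and observability\<close>

text \<open>Vectors of length \<open>n\<close> are functions of which only the values below \<open>n\<close> count.  By induction on \<open>n\<close>:
  either the projection to the first \<open>n\<close> coordinates is proper already, or the subspace is the graph
  of a linear functional on these coordinates, since otherwise it would contain the last unit vector
  and hence everything.\<close>

lemma proper_subspace_annihilator:
  fixes S :: "(nat \<Rightarrow> 'a::field) set"
  assumes zero: "(\<lambda>i. 0) \<in> S"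
    and add: "\<And>x y. x \<in> S \<Longrightarrow> y \<in> S \<Longrightarrow> (\<lambda>i. x i + y i) \<in> S"
    and scale: "\<And>c x. x \<in> S \<Longrightarrow> (\<lambda>i. c * x i) \<in> S"
    and proper: "\<And>x. x \<in> S \<Longrightarrow> \<exists>i<n. x i \<noteq> c i"
  shows "\<exists>q. (\<exists>i<n. q i \<noteq> 0) \<and> (\<forall>x\<in>S. (\<Sum>i<n. q i * x i) = 0)"
  using proper
proof (induction n arbitrary: c)
  case 0
  then show ?case using zero by blast
next
  case (Suc n)
  show ?case
  proof (cases "\<exists>c. \<forall>x\<in>S. \<exists>i<n. x i \<noteq> c i")
    case True
    then obtain q where q: "\<exists>i<n. q i \<noteq> 0" "\<forall>x\<in>S. (\<Sum>i<n. q i * x i) = 0"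
      using Suc.IH by metis
    have "(\<Sum>i<Suc n. (q(n := 0)) i * x i) = 0" if "x \<in> S" for x
      using q(2) that by (simp cong: sum.cong_simp)
    moreover have "\<exists>i<Suc n. (q(n := 0)) i \<noteq> 0"
      using q(1) by (metis fun_upd_other less_Suc_eq less_irrefl)
    ultimately show ?thesis by blast
  next
    case False
    then have onto: "\<exists>x\<in>S. \<forall>i<n. x i = c i" for c by metis
    have graph: "e n = 0" if "e \<in> S" "\<forall>i<n. e i = 0" for e
    proof (rule ccontr)
      assume "e n \<noteq> 0"
      obtain x where x: "x \<in> S" "\<forall>i<n. x i = c i" using onto by blast
      define d where "d = (c n - x n) / e n"
      have "(\<lambda>i. x i + d * e i) \<in> S" by (intro add scale x that)
      moreover have "\<forall>i<Suc n. x i + d * e i = c i"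
        using x(2) that(2) \<open>e n \<noteq> 0\<close> by (auto simp: less_Suc_eq d_def)
      ultimately show False using Suc.prems by blast
    qed
    have "\<forall>k. \<exists>x. x \<in> S \<and> (\<forall>i<n. x i = (if i = k then 1 else 0))"
      unfolding Bex_def[symmetric] by (intro allI onto)
    from choice[OF this] obtain s
      where s0: "\<forall>k. s k \<in> S \<and> (\<forall>i<n. s k i = (if i = k then 1 else 0))"
      by (elim exE) (rule that)
    have s: "s k \<in> S" "i < n \<Longrightarrow> s k i = (if i = k then 1 else 0)" for k i
      using s0 by simp_all
    define q where "q i = (if i < n then s i n else - 1)" for i
    have comb: "(\<lambda>i. \<Sum>k<m. y k * s k i) \<in> S" for m y
    proof (induction m)
      case (Suc m)
      then show ?case using add[OF Suc.IH scale[OF s(1)]] by simp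
    qed (simp add: zero)
    have "(\<Sum>i<Suc n. q i * x i) = 0" if "x \<in> S" for x
    proof -
      have "(\<lambda>i. x i + (\<Sum>k<n. - x k * s k i)) \<in> S" by (rule add[OF that comb])
      moreover have "x i + (\<Sum>k<n. - x k * s k i) = 0" if "i < n" for i
      proof -
        have "(\<Sum>k<n. - x k * s k i) = (\<Sum>k<n. if k = i then - x k else 0)"
          using s(2)[OF that] by (intro sum.cong) auto
        then show ?thesis using that by simp
      qed
      ultimately have "x n + (\<Sum>k<n. - x k * s k n) = 0" using graph by blast
      then have "x n = (\<Sum>k<n. s k n * x k)" by (simp add: sum_negf mult.commute)
      moreover have "(\<Sum>i<n. q i * x i) = (\<Sum>k<n. s k n * x k)" by (rule sum.cong) (auto simp: q_def)
      ultimately show ?thesis by (simp add: q_def)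
    qed
    then show ?thesis by (intro exI[of _ q]) (auto simp: q_def)
  qed
qed

lemma locally_integrable_borel_measurable:
  fixes f :: "real \<Rightarrow> 'a::euclidean_space"
  assumes f: "locally_integrable f"
  shows "f \<in> borel_measurable lebesgue"
proof (rule borel_measurable_LIMSEQ_metric)
  fix k :: nat
  have "set_integrable lebesgue {- real k..real k} f" using f by (simp add: locally_integrable_def)
  then show "(\<lambda>t. indicator {- real k..real k} t *\<^sub>R f t) \<in> borel_measurable lebesgue"
    unfolding set_integrable_def by (rule borel_measurable_integrable)
next
  fix t :: real
  show "(\<lambda>k. indicator {- real k..real k} t *\<^sub>R f t) \<longlonglongrightarrow> f t"
  proof (rule tendsto_eventually)
    show "\<forall>\<^sub>F k in sequentially. indicator {- real k..real k} t *\<^sub>R f t = f t"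
      using eventually_ge_at_top[of "nat \<lceil>\<bar>t\<bar>\<rceil>"]
      by eventually_elim (auto simp: indicator_def nat_ceiling_le_eq)
  qed
qed

lemma AE_eq_0_if_has_integral_norm_0:
  fixes g :: "real \<Rightarrow> 'a::euclidean_space"
  assumes g: "locally_integrable g" and 0: "((\<lambda>t. norm (g t)) has_integral 0) {s..t}"
  shows "AE \<theta> in lebesgue. \<theta> \<in> {s..t} \<longrightarrow> g \<theta> = 0"
proof -
  have si: "set_integrable lebesgue {s..t} (\<lambda>\<theta>. norm (g \<theta>))"
    using locally_integrable_norm[OF g] by (simp add: locally_integrable_def)
  then have "(LINT \<theta>:{s..t} | lebesgue. norm (g \<theta>)) = 0"
    using set_lebesgue_integral_eq_integral(2)[OF si] integral_unique[OF 0] by simp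
  then have "AE \<theta> in lebesgue. indicator {s..t} \<theta> *\<^sub>R norm (g \<theta>) = 0"
    using si unfolding set_integrable_def set_lebesgue_integral_def
    by (subst (asm) integral_nonneg_eq_0_iff_AE) auto
  then show ?thesis by eventually_elim (auto simp: indicator_def)
qed

text \<open>The homogeneous parts of \<open>x' = a x + v\<close> and of \<open>p' = - a\<^sup>T p\<close> cancel in the derivative of \<open>p\<^sup>T x\<close>.\<close>

lemma costate_state_pairing:
  fixes p x v :: "nat \<Rightarrow> real \<Rightarrow> 'a::{real_normed_field, euclidean_space}"
  assumes "s \<le> t"
    and p: "\<And>i. i < n \<Longrightarrow> abs_continuous_on {s..t} (p i)" and x: "\<And>i. i < n \<Longrightarrow> abs_continuous_on {s..t} (x i)"
    and dp: "AE \<theta> in lebesgue. \<theta> \<in> {s..t} \<longrightarrow>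
      (\<forall>i<n. (p i has_vector_derivative - (\<Sum>j<n. a j i \<theta> * p j \<theta>)) (at \<theta> within {s..t}))"
    and dx: "AE \<theta> in lebesgue. \<theta> \<in> {s..t} \<longrightarrow>
      (\<forall>i<n. (x i has_vector_derivative (\<Sum>j<n. a i j \<theta> * x j \<theta>) + v i \<theta>) (at \<theta> within {s..t}))"
  shows "((\<lambda>\<theta>. \<Sum>i<n. p i \<theta> * v i \<theta>) has_integral (\<Sum>i<n. p i t * x i t) - (\<Sum>i<n. p i s * x i s)) {s..t}"
proof (rule abs_continuous_on_has_integral[OF \<open>s \<le> t\<close>])
  show "abs_continuous_on {s..t} (\<lambda>\<theta>. \<Sum>i<n. p i \<theta> * x i \<theta>)"
    using p x by (intro abs_continuous_on_sum abs_continuous_on_mult) auto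
  show "AE \<theta> in lebesgue. \<theta> \<in> {s..t} \<longrightarrow>
     ((\<lambda>\<theta>. \<Sum>i<n. p i \<theta> * x i \<theta>) has_vector_derivative (\<Sum>i<n. p i \<theta> * v i \<theta>)) (at \<theta> within {s..t})"
    using dp dx
  proof eventually_elim
    case (elim \<theta>)
    show ?case
    proof
      assume \<theta>: "\<theta> \<in> {s..t}"
      let ?A = "\<lambda>i. \<Sum>j<n. a i j \<theta> * x j \<theta>" and ?B = "\<lambda>i. \<Sum>j<n. a j i \<theta> * p j \<theta>"
      have "((\<lambda>\<theta>. \<Sum>i<n. p i \<theta> * x i \<theta>) has_vector_derivative
          (\<Sum>i<n. p i \<theta> * (?A i + v i \<theta>) + - ?B i * x i \<theta>)) (at \<theta> within {s..t})"
        using elim \<theta> by (intro has_vector_derivative_sum has_vector_derivative_mult) auto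
      also have "(\<Sum>i<n. p i \<theta> * (?A i + v i \<theta>) + - ?B i * x i \<theta>)
          = (\<Sum>i<n. p i \<theta> * v i \<theta>) + ((\<Sum>i<n. p i \<theta> * ?A i) - (\<Sum>i<n. ?B i * x i \<theta>))"
        by (simp add: sum.distrib sum_subtractf algebra_simps)
      also have "(\<Sum>i<n. ?B i * x i \<theta>) = (\<Sum>i<n. \<Sum>j<n. p j \<theta> * (a j i \<theta> * x i \<theta>))"
        unfolding sum_distrib_right by (intro sum.cong refl) (simp add: mult_ac)
      also have "\<dots> = (\<Sum>i<n. p i \<theta> * ?A i)"
        by (subst sum.swap) (simp add: sum_distrib_left)
      finally show "((\<lambda>\<theta>. \<Sum>i<n. p i \<theta> * x i \<theta>) has_vector_derivative (\<Sum>i<n. p i \<theta> * v i \<theta>)) (at \<theta> within {s..t})"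
        by simp
    qed
  qed
qed

text \<open>Globally bounded inputs suffice for steering, and they are closed under linear combinations.\<close>

definition bounded_input :: "nat \<Rightarrow> (nat \<Rightarrow> real \<Rightarrow> 'a::real_normed_vector) \<Rightarrow> bool" where
  "bounded_input r u \<longleftrightarrow> (\<forall>k<r. u k \<in> borel_measurable lebesgue \<and> bounded (range (u k)))"

locale linear_control_system =
  fixes n r :: nat and a b :: "nat \<Rightarrow> nat \<Rightarrow> real \<Rightarrow> 'a::{real_normed_field, euclidean_space}"
  assumes a: "\<And>i j. i < n \<Longrightarrow> j < n \<Longrightarrow> locally_integrable (a i j)"
    and b: "\<And>i k. i < n \<Longrightarrow> k < r \<Longrightarrow> locally_integrable (b i k)"
begin

definition vector_field :: "(nat \<Rightarrow> real \<Rightarrow> 'a) \<Rightarrow> (nat \<Rightarrow> real \<Rightarrow> 'a) \<Rightarrow> nat \<Rightarrow> real \<Rightarrow> 'a" where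
  "vector_field u x i s = (\<Sum>j<n. a i j s * x j s) + (\<Sum>k<r. b i k s * u k s)"

definition trajectory :: "real \<Rightarrow> (nat \<Rightarrow> 'a) \<Rightarrow> (nat \<Rightarrow> real \<Rightarrow> 'a) \<Rightarrow> (nat \<Rightarrow> real \<Rightarrow> 'a) \<Rightarrow> bool" where
  "trajectory \<tau> c u x \<longleftrightarrow> bounded_input r u \<and>
     (\<forall>i<n. continuous_on UNIV (x i) \<and> (\<forall>t. x i t = c i + integral {\<tau>..t} (vector_field u x i)))"

lemma locally_integrable_input:
  assumes "bounded_input r u" "i < n" "k < r"
  shows "locally_integrable (\<lambda>s. b i k s * u k s)"
  using assms unfolding bounded_input_def
  by (intro locally_integrable_mult b) (auto intro: bounded_subset)

lemma locally_integrable_vector_field: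
  assumes "bounded_input r u" "\<And>j. j < n \<Longrightarrow> continuous_on UNIV (x j)" "i < n"
  shows "locally_integrable (vector_field u x i)"
  unfolding vector_field_def[abs_def]
  by (intro locally_integrable_add locally_integrable_sum locally_integrable_input
      locally_integrable_mult_continuous a) (use assms in auto)

lemma trajectory_vector_field: "trajectory \<tau> c u x \<Longrightarrow> i < n \<Longrightarrow> locally_integrable (vector_field u x i)"
  unfolding trajectory_def by (intro locally_integrable_vector_field) auto

lemma trajectory_eq: "trajectory \<tau> c u x \<Longrightarrow> i < n \<Longrightarrow> x i t = c i + integral {\<tau>..t} (vector_field u x i)"
  unfolding trajectory_def by blast

lemma trajectory_start: "trajectory \<tau> c u x \<Longrightarrow> i < n \<Longrightarrow> x i \<tau> = c i"
  by (simp add: trajectory_eq[of \<tau> c u x i \<tau>])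

lemma trajectory_abs_continuous_on:
  assumes "trajectory \<tau> c u x" "i < n"
  shows "abs_continuous_on {\<tau>..T} (x i)"
  by (rule primitive_abs_continuous_on[OF trajectory_vector_field[OF assms] trajectory_eq[OF assms]])

lemma trajectory_has_vector_derivative:
  assumes "trajectory \<tau> c u x"
  shows "AE t in lebesgue. t \<in> {\<tau>..T} \<longrightarrow> (\<forall>i<n. (x i has_vector_derivative vector_field u x i t) (at t within {\<tau>..T}))"
proof -
  have "AE t in lebesgue. \<forall>i\<in>{..<n}. t \<in> {\<tau>..T} \<longrightarrow> (x i has_vector_derivative vector_field u x i t) (at t within {\<tau>..T})"
    using assms
    by (intro AE_finite_allI primitive_has_vector_derivative[OF trajectory_vector_field trajectory_eq]) auto
  then show ?thesis by eventually_elim auto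
qed

lemma trajectory_exists:
  assumes "bounded_input r u"
  shows "\<exists>x. trajectory \<tau> c u x"
proof -
  interpret ode: linear_ode n a "\<lambda>i s. \<Sum>k<r. b i k s * u k s" \<tau> c
    by standard (use assms a locally_integrable_input in \<open>auto intro!: locally_integrable_sum\<close>)
  show ?thesis using ode.solution_exists assms unfolding trajectory_def vector_field_def[abs_def] by blast
qed

lemma trajectory_add:
  assumes 1: "trajectory \<tau> c u x" and 2: "trajectory \<tau> d v y"
  shows "trajectory \<tau> (\<lambda>i. c i + d i) (\<lambda>k t. u k t + v k t) (\<lambda>i t. x i t + y i t)"
  unfolding trajectory_def
proof (intro conjI allI impI)
  have "bounded (range (\<lambda>t. u k t + v k t))" if "k < r" for k
    using 1 2 that unfolding trajectory_def bounded_input_def by (intro bounded_plus_comp) auto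
  then show "bounded_input r (\<lambda>k t. u k t + v k t)"
    using 1 2 unfolding trajectory_def bounded_input_def by (auto intro!: borel_measurable_add)
  fix i assume i: "i < n"
  show "continuous_on UNIV (\<lambda>t. x i t + y i t)"
    using 1 2 i unfolding trajectory_def by (intro continuous_intros) auto
  fix t
  have "vector_field (\<lambda>k t. u k t + v k t) (\<lambda>i t. x i t + y i t) i
      = (\<lambda>s. vector_field u x i s + vector_field v y i s)"
    by (simp add: vector_field_def fun_eq_iff algebra_simps sum.distrib)
  then have "integral {\<tau>..t} (vector_field (\<lambda>k t. u k t + v k t) (\<lambda>i t. x i t + y i t) i)
      = integral {\<tau>..t} (vector_field u x i) + integral {\<tau>..t} (vector_field v y i)"
    using Henstock_Kurzweil_Integration.integral_add[OF locally_integrableD[OF trajectory_vector_field[OF 1 i]]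
        locally_integrableD[OF trajectory_vector_field[OF 2 i]]] by simp
  then show "x i t + y i t = c i + d i + integral {\<tau>..t} (vector_field (\<lambda>k t. u k t + v k t) (\<lambda>i t. x i t + y i t) i)"
    using trajectory_eq[OF 1 i, of t] trajectory_eq[OF 2 i, of t] by simp
qed

lemma trajectory_scale:
  assumes 1: "trajectory \<tau> c u x"
  shows "trajectory \<tau> (\<lambda>i. e * c i) (\<lambda>k t. e * u k t) (\<lambda>i t. e * x i t)"
  unfolding trajectory_def
proof (intro conjI allI impI)
  have "bounded (range (\<lambda>t. e * u k t))" if "k < r" for k
  proof -
    have "bounded ((*) e ` range (u k))"
      using 1 that unfolding trajectory_def bounded_input_def
      by (intro bounded_linear_image[OF _ bounded_linear_mult_right]) auto
    then show ?thesis by (simp add: image_image)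
  qed
  then show "bounded_input r (\<lambda>k t. e * u k t)"
    using 1 unfolding trajectory_def bounded_input_def by (auto intro!: borel_measurable_times)
  fix i assume i: "i < n"
  show "continuous_on UNIV (\<lambda>t. e * x i t)"
    using 1 i unfolding trajectory_def by (intro continuous_intros) auto
  fix t
  have "vector_field (\<lambda>k t. e * u k t) (\<lambda>i t. e * x i t) i = (\<lambda>s. e * vector_field u x i s)"
    by (simp add: vector_field_def fun_eq_iff algebra_simps sum_distrib_left)
  then show "e * x i t = e * c i + integral {\<tau>..t} (vector_field (\<lambda>k t. e * u k t) (\<lambda>i t. e * x i t) i)"
    using trajectory_eq[OF 1 i, of t] by (simp add: algebra_simps)
qed

definition costate :: "real \<Rightarrow> real \<Rightarrow> (nat \<Rightarrow> real \<Rightarrow> 'a) \<Rightarrow> bool" where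
  "costate s t p \<longleftrightarrow> (\<forall>i<n. abs_continuous_on {s..t} (p i)) \<and>
     (AE \<theta> in lebesgue. \<theta> \<in> {s..t} \<longrightarrow>
       (\<forall>i<n. (p i has_vector_derivative - (\<Sum>j<n. a j i \<theta> * p j \<theta>)) (at \<theta> within {s..t})))"

text \<open>A costate with prescribed final value is obtained from a forward solution by reversing time.\<close>

lemma costate_exists:
  obtains p where "costate s t p" "\<And>i. i < n \<Longrightarrow> continuous_on UNIV (p i)" "\<And>i. i < n \<Longrightarrow> p i t = q i"
proof -
  interpret ode: linear_ode n "\<lambda>i j \<theta>. a j i (- \<theta>)" "\<lambda>i \<theta>. 0" "- t" q
  proof
    show "locally_integrable (\<lambda>\<theta>. a j i (- \<theta>))" if "i < n" "j < n" for i j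
      by (rule locally_integrable_reflect[OF a[OF that(2,1)]])
    show "locally_integrable (\<lambda>\<theta>::real. 0::'a)" by (simp add: locally_integrable_def)
  qed
  obtain x where x: "\<And>i. i < n \<Longrightarrow> continuous_on UNIV (x i)"
    "\<And>i \<theta>. i < n \<Longrightarrow> x i \<theta> = q i + integral {- t..\<theta>} (\<lambda>s. (\<Sum>j<n. a j i (- s) * x j s) + 0)"
    using ode.solution_exists by blast
  define p where "p i \<theta> = x i (- \<theta>)" for i \<theta>
  define f where "f i \<theta> = - (\<Sum>j<n. a j i \<theta> * p j \<theta>)" for i \<theta>
  have p_cont: "continuous_on UNIV (p i)" if "i < n" for i
    unfolding p_def[abs_def] by (rule continuous_on_compose2[OF x(1)[OF that]]) (auto intro!: continuous_intros)
  have f: "locally_integrable (f i)" if "i < n" for i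
  proof -
    have "f i = (\<lambda>\<theta>. \<Sum>j<n. a j i \<theta> * (- p j \<theta>))" by (simp add: f_def fun_eq_iff sum_negf)
    moreover have "locally_integrable \<dots>"
      by (intro locally_integrable_sum locally_integrable_mult_continuous a continuous_intros p_cont) (use that in auto)
    ultimately show ?thesis by simp
  qed
  have p_eq: "p i \<theta> = q i - integral {\<theta>..t} (f i)" if "i < n" for i \<theta>
  proof -
    have "p i \<theta> = q i + integral {- t..- \<theta>} (\<lambda>s. - f i (- s))"
      using x(2)[OF that, of "- \<theta>"] by (simp add: p_def f_def)
    also have "integral {- t..- \<theta>} (\<lambda>s. - f i (- s)) = integral {\<theta>..t} (\<lambda>s. - f i s)"
      by (rule Henstock_Kurzweil_Integration.integral_reflect_real[of t \<theta> "\<lambda>s. - f i s"])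
    finally show ?thesis by simp
  qed
  have prim: "p i \<theta> = p i s + integral {s..\<theta>} (f i)" if "i < n" "\<theta> \<in> {s..t}" for i \<theta>
  proof -
    have "integral {s..t} (f i) = integral {s..\<theta>} (f i) + integral {\<theta>..t} (f i)"
      using Henstock_Kurzweil_Integration.integral_combine[of s \<theta> t "f i"] that
        locally_integrableD[OF f[OF that(1)], of s t] by simp
    then show ?thesis unfolding p_eq[OF that(1)] by simp
  qed
  show thesis
  proof (rule that[of p])
    have "AE \<theta> in lebesgue. \<forall>i\<in>{..<n}. \<theta> \<in> {s..t} \<longrightarrow> (p i has_vector_derivative f i \<theta>) (at \<theta> within {s..t})"
      by (intro AE_finite_allI primitive_has_vector_derivative[OF f prim]) auto
    then have "AE \<theta> in lebesgue. \<theta> \<in> {s..t} \<longrightarrow>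
       (\<forall>i<n. (p i has_vector_derivative - (\<Sum>j<n. a j i \<theta> * p j \<theta>)) (at \<theta> within {s..t}))"
      by eventually_elim (auto simp: f_def)
    then show "costate s t p"
      unfolding costate_def using primitive_abs_continuous_on[OF f prim] by blast
    show "p i t = q i" if "i < n" for i using p_eq[OF that, of t] by simp
  qed (use p_cont in blast)
qed

text \<open>If the subspace \<open>S\<close> of states reachable from 0 is proper, a functional \<open>q\<close> that annihilates it is
  continued to a costate \<open>p\<close>.  Testing with the input that has the phase of the conjugate of the
  \<open>k\<close>th component \<open>g\<close> of \<open>b\<^sup>T p\<close> gives \<open>\<integral> norm g = 0\<close>, and so \<open>p\<close> is unobservable.\<close>

theorem controllable_if_observable:
  assumes "t0 \<le> t1"
    and observable: "\<And>p. costate t0 t1 p \<Longrightarrow>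
       (\<And>k. k < r \<Longrightarrow> AE t in lebesgue. t \<in> {t0..t1} \<longrightarrow> (\<Sum>i<n. p i t * b i k t) = 0) \<Longrightarrow> \<forall>i<n. p i t1 = 0"
  shows "\<exists>u x. trajectory t0 c u x \<and> (\<forall>i<n. x i t1 = d i)"
proof -
  have zero: "bounded_input r (\<lambda>k t. 0 :: 'a)" by (simp add: bounded_input_def)
  obtain z where z: "trajectory t0 c (\<lambda>k t. 0) z" using trajectory_exists[OF zero] by blast
  define S where "S = {y. \<exists>u x. trajectory t0 (\<lambda>i. 0) u x \<and> y = (\<lambda>i. x i t1)}"
  have "\<exists>y\<in>S. \<forall>i<n. y i = d i - z i t1"
  proof (rule ccontr)
    assume not: "\<not> ?thesis"
    have "\<exists>q. (\<exists>i<n. q i \<noteq> 0) \<and> (\<forall>x\<in>S. (\<Sum>i<n. q i * x i) = 0)"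
    proof (rule proper_subspace_annihilator)
      have "trajectory t0 (\<lambda>i. 0) (\<lambda>k t. 0) (\<lambda>i t. 0)"
        using zero by (auto simp: trajectory_def vector_field_def[abs_def])
      then show "(\<lambda>i. 0) \<in> S" unfolding S_def by fastforce
      show "(\<lambda>i. x i + y i) \<in> S" if xy: "x \<in> S" "y \<in> S" for x y
      proof -
        obtain u x' v y' where *: "trajectory t0 (\<lambda>i. 0) u x'" "x = (\<lambda>i. x' i t1)"
          "trajectory t0 (\<lambda>i. 0) v y'" "y = (\<lambda>i. y' i t1)"
          using xy unfolding S_def by blast
        show ?thesis using trajectory_add[OF *(1,3)] unfolding S_def *(2,4) by auto
      qed
      show "(\<lambda>i. e * x i) \<in> S" if x: "x \<in> S" for e x
      proof -
        obtain u x' where *: "trajectory t0 (\<lambda>i. 0) u x'" "x = (\<lambda>i. x' i t1)"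
          using x unfolding S_def by blast
        show ?thesis using trajectory_scale[OF *(1), of e] unfolding S_def *(2) by auto
      qed
      show "\<exists>i<n. x i \<noteq> d i - z i t1" if "x \<in> S" for x
        using not that by (simp only: Bex_def) auto
    qed
    then obtain q where qS: "(\<exists>i<n. q i \<noteq> 0) \<and> (\<forall>x\<in>S. (\<Sum>i<n. q i * x i) = 0)"
      by (rule exE) (rule that)
    note q = conjunct1[OF qS] and q_S = conjunct2[OF qS]
    have ann: "(\<Sum>i<n. q i * x i t1) = 0" if "trajectory t0 (\<lambda>i. 0) u x" for u x
    proof -
      have "(\<lambda>i. x i t1) \<in> S" unfolding S_def using that by auto
      then show ?thesis using q_S by (rule bspec[rotated])
    qed
    obtain p where p: "costate t0 t1 p" "\<And>i. i < n \<Longrightarrow> continuous_on UNIV (p i)" "\<And>i. i < n \<Longrightarrow> p i t1 = q i"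
      by (rule costate_exists[of t0 t1 q]) (rule that)
    have "AE t in lebesgue. t \<in> {t0..t1} \<longrightarrow> (\<Sum>i<n. p i t * b i k t) = 0" if k: "k < r" for k
    proof (rule AE_eq_0_if_has_integral_norm_0)
      define g where "g t = (\<Sum>i<n. p i t * b i k t)" for t
      have g_eq: "g = (\<lambda>t. \<Sum>i<n. b i k t * p i t)" by (simp add: g_def fun_eq_iff mult.commute)
      show g: "locally_integrable (\<lambda>t. \<Sum>i<n. p i t * b i k t)"
        unfolding g_def[symmetric] g_eq
        by (intro locally_integrable_sum locally_integrable_mult_continuous b p(2) k) auto
      \<comment> \<open>on the interval \<open>g * u k = norm g\<close>; where \<open>g\<close> vanishes, the quotient is 0\<close>
      define u where "u l t = (if l = k then indicator {t0..t1} t *\<^sub>R (of_real (norm (g t)) / g t) else 0)" for l t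
      have [measurable]: "g \<in> borel_measurable lebesgue"
        using locally_integrable_borel_measurable[OF g] by (simp add: g_def[abs_def])
      have "u l \<in> borel_measurable lebesgue" for l
      proof (cases "l = k")
        case True
        have [measurable]: "{t0..t1} \<in> sets lebesgue" by simp
        have "(\<lambda>t. indicator {t0..t1} t *\<^sub>R (of_real (norm (g t)) / g t)) \<in> borel_measurable lebesgue"
          by measurable
        then show ?thesis using True by (simp add: u_def[abs_def])
      qed (simp add: u_def[abs_def])
      moreover have "norm (u l t) \<le> 1" for l t
        by (cases "g t = 0") (simp_all add: u_def norm_divide indicator_def)
      ultimately have u: "bounded_input r u"
        unfolding bounded_input_def bounded_iff by blast
      obtain x where x: "trajectory t0 (\<lambda>i. 0) u x" using trajectory_exists[OF u] by blast
      have bu: "(\<Sum>l<r. b i l t * u l t) = b i k t * u k t" for i t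
      proof -
        have "(\<Sum>l<r. b i l t * u l t) = (\<Sum>l<r. if l = k then b i k t * u k t else 0)"
          by (rule sum.cong) (auto simp: u_def)
        then show ?thesis using k by simp
      qed
      have "((\<lambda>t. \<Sum>i<n. p i t * (b i k t * u k t)) has_integral
          (\<Sum>i<n. p i t1 * x i t1) - (\<Sum>i<n. p i t0 * x i t0)) {t0..t1}"
      proof (rule costate_state_pairing[OF \<open>t0 \<le> t1\<close>])
        show "AE \<theta> in lebesgue. \<theta> \<in> {t0..t1} \<longrightarrow> (\<forall>i<n. (x i has_vector_derivative
            (\<Sum>j<n. a i j \<theta> * x j \<theta>) + b i k \<theta> * u k \<theta>) (at \<theta> within {t0..t1}))"
          using trajectory_has_vector_derivative[OF x, of t1] by (simp add: vector_field_def bu)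
      qed (use p(1) x trajectory_abs_continuous_on in \<open>auto simp: costate_def\<close>)
      also have "(\<Sum>i<n. p i t1 * x i t1) = 0" using ann[OF x] p(3) by simp
      also have "(\<Sum>i<n. p i t0 * x i t0) = 0" using trajectory_start[OF x] by simp
      finally have "((\<lambda>t. \<Sum>i<n. p i t * (b i k t * u k t)) has_integral 0) {t0..t1}" by simp
      moreover have "(\<Sum>i<n. p i t * (b i k t * u k t)) = of_real (norm (g t))" if "t \<in> {t0..t1}" for t
      proof -
        have "(\<Sum>i<n. p i t * (b i k t * u k t)) = g t * u k t"
          by (simp add: g_def sum_distrib_right mult.assoc)
        also have "\<dots> = of_real (norm (g t))" using that by (simp add: u_def)
        finally show ?thesis .
      qed
      ultimately have 0: "((\<lambda>t. of_real (norm (g t)) :: 'a) has_integral 0) {t0..t1}"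
        by (rule has_integral_eq[rotated])
      have int: "(\<lambda>t. norm (g t)) integrable_on {t0..t1}"
        using locally_integrableD[OF locally_integrable_norm[OF g]] by (simp add: g_def)
      have "((\<lambda>t. of_real (norm (g t)) :: 'a) has_integral of_real (integral {t0..t1} (\<lambda>t. norm (g t)))) {t0..t1}"
        using has_integral_linear[OF integrable_integral[OF int] bounded_linear_of_real] by (simp add: o_def)
      then have "of_real (integral {t0..t1} (\<lambda>t. norm (g t))) = (0 :: 'a)"
        using 0 by (rule has_integral_unique)
      then have "integral {t0..t1} (\<lambda>t. norm (g t)) = 0" by (simp only: of_real_eq_0_iff)
      then show "((\<lambda>t. norm (\<Sum>i<n. p i t * b i k t)) has_integral 0) {t0..t1}"
        using integrable_integral[OF int] unfolding g_def by (simp only:)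
    qed
    then have "\<forall>i<n. p i t1 = 0" by (rule observable[OF p(1)])
    then show False using q p(3) by auto
  qed
  then obtain u y where y: "trajectory t0 (\<lambda>i. 0) u y" "\<forall>i<n. y i t1 = d i - z i t1"
    unfolding S_def by blast
  have "trajectory t0 c (\<lambda>k t. u k t) (\<lambda>i t. z i t + y i t)"
    using trajectory_add[OF z y(1)] by simp
  moreover have "\<forall>i<n. z i t1 + y i t1 = d i" using y(2) by simp
  ultimately show ?thesis by blast
qed

end

section \<open>Costates and the graph condition\<close>

text \<open>Condition (\<open>G\<^sub>4\<close>) for an arbitrary edge relation, so that the entries of time-varying matrices can
  be compared with it directly.\<close>

definition sole_successor_property :: "nat \<Rightarrow> nat \<Rightarrow> (nat \<Rightarrow> nat \<Rightarrow> bool) \<Rightarrow> bool" where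
  "sole_successor_property n r edge \<longleftrightarrow>
     (\<forall>V. V \<noteq> {} \<and> V \<subseteq> {..<n} \<longrightarrow> (\<exists>v<n + r. v \<notin> V \<and> (\<exists>!w. w \<in> V \<and> edge v w)))"

text \<open>The set of nonzero components can only grow in a neighbourhood of a given time, by continuity;
  where it is largest, it is therefore locally constant.\<close>

lemma stable_support:
  fixes p :: "nat \<Rightarrow> real \<Rightarrow> 'a::real_normed_vector"
  assumes "t0 < t1" and p: "\<And>i. i < n \<Longrightarrow> continuous_on {t0..t1} (p i)" and i0: "i0 < n" "p i0 t1 \<noteq> 0"
  shows "\<exists>U V. (open U \<and> U \<noteq> {} \<and> U \<subseteq> {t0<..<t1}) \<and> (V \<noteq> {} \<and> V \<subseteq> {..<n}) \<and>
    (\<forall>t\<in>U. \<forall>i<n. p i t \<noteq> 0 \<longleftrightarrow> i \<in> V)"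
proof -
  define I where "I = {t0<..<t1}"
  define N where "N t = {i. i < n \<and> p i t \<noteq> 0}" for t
  have fin: "finite (N t)" for t by (simp add: N_def)
  have card_N: "card (N t) < Suc n" for t
  proof -
    have "card (N t) \<le> card {..<n}" by (rule card_mono) (auto simp: N_def)
    then show ?thesis by simp
  qed
  have pI: "continuous_on I (p i)" if "i < n" for i
    by (rule continuous_on_subset[OF p[OF that]]) (auto simp: I_def)
  obtain t where t: "t \<in> I" "N t \<noteq> {}"
  proof -
    have "norm (p i0 t1) > 0" using i0(2) by simp
    then have "\<exists>d>0. \<forall>t\<in>{t0..t1}. dist t t1 < d \<longrightarrow> dist (p i0 t) (p i0 t1) < norm (p i0 t1)"
      using p[OF i0(1), unfolded continuous_on_iff, rule_format, of t1 "norm (p i0 t1)"] \<open>t0 < t1\<close> by simp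
    then obtain d where d: "d > 0" "\<And>t. t \<in> {t0..t1} \<Longrightarrow> dist t t1 < d \<Longrightarrow> dist (p i0 t) (p i0 t1) < norm (p i0 t1)"
      by auto
    define t where "t = max ((t0 + t1) / 2) (t1 - d / 2)"
    have "t \<in> I" "dist t t1 < d" using \<open>t0 < t1\<close> d(1) by (auto simp: t_def I_def dist_real_def max_def field_simps)
    then have "dist (p i0 t) (p i0 t1) < norm (p i0 t1)" using d(2)[of t] by (auto simp: I_def)
    then have "p i0 t \<noteq> 0" by auto
    then have "i0 \<in> N t" using i0(1) by (simp add: N_def)
    then show thesis using \<open>t \<in> I\<close> by (intro that[of t]) auto
  qed
  \<comment> \<open>at a point of maximal support no component can become nonzero, and none vanishes nearby\<close>
  obtain s where s: "s \<in> I" "\<And>t. t \<in> I \<Longrightarrow> card (N t) \<le> card (N s)"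
    using ex_has_greatest_nat[of "\<lambda>t. t \<in> I" t "\<lambda>t. card (N t)" "Suc n"] t(1) card_N by blast
  define U where "U = I \<inter> (\<Inter>i\<in>N s. I \<inter> p i -` (- {0}))"
  have "open I" by (simp add: I_def)
  have "open (\<Inter>i\<in>N s. I \<inter> p i -` (- {0}))"
    by (intro open_INT fin ballI continuous_open_preimage pI) (auto simp: N_def \<open>open I\<close>)
  then have "open U" unfolding U_def using \<open>open I\<close> by (rule open_Int[rotated])
  moreover have "s \<in> U" using s(1) by (auto simp: U_def N_def)
  moreover have "N s \<noteq> {}"
    using s(2)[OF t(1)] t(2) fin[of t] by (metis card_gt_0_iff card.empty le_zero_eq not_less_zero)
  moreover have "p i t \<noteq> 0 \<longleftrightarrow> i \<in> N s" if tU: "t \<in> U" and i: "i < n" for t i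
  proof -
    have "t \<in> I" using tU by (simp add: U_def)
    have "N s \<subseteq> N t"
    proof
      fix j assume j: "j \<in> N s"
      then have "t \<in> p j -` (- {0})" using tU unfolding U_def by blast
      then show "j \<in> N t" using j by (simp add: N_def)
    qed
    then have "N s = N t" using s(2)[OF \<open>t \<in> I\<close>] fin by (intro card_seteq)
    then show ?thesis using i by (simp add: N_def)
  qed
  moreover have "U \<subseteq> {t0<..<t1}" "N s \<subseteq> {..<n}" by (auto simp: U_def I_def N_def)
  ultimately show ?thesis by (intro exI[of _ U] exI[of _ "N s"] conjI ballI allI impI) auto
qed

text \<open>On an open set \<open>U\<close> of times on which the support of \<open>p\<close> is a fixed set \<open>V\<close>, the equation belonging to
  the vertex \<open>v\<close> has a single nonzero summand, the one of its sole successor \<open>w\<close>.\<close>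

lemma sole_successor_costate_eq_0:
  fixes a b :: "nat \<Rightarrow> nat \<Rightarrow> real \<Rightarrow> 'a::{real_normed_field, euclidean_space}"
  assumes "t0 < t1" and G: "sole_successor_property n r edge"
    and a: "AE t in lebesgue. \<forall>i<n. \<forall>j<n. a i j t \<noteq> 0 \<longleftrightarrow> edge j i"
    and b: "AE t in lebesgue. \<forall>i<n. \<forall>k<r. b i k t \<noteq> 0 \<longleftrightarrow> edge (n + k) i"
    and p: "\<And>i. i < n \<Longrightarrow> continuous_on {t0..t1} (p i)"
    and dp: "AE t in lebesgue. t \<in> {t0..t1} \<longrightarrow>
      (\<forall>i<n. (p i has_vector_derivative - (\<Sum>j<n. a j i t * p j t)) (at t within {t0..t1}))"
    and pb: "\<And>k. k < r \<Longrightarrow> AE t in lebesgue. t \<in> {t0..t1} \<longrightarrow> (\<Sum>i<n. p i t * b i k t) = 0"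
    and "i < n"
  shows "p i t1 = 0"
proof (rule ccontr)
  assume "p i t1 \<noteq> 0"
  have "\<exists>U V. (open U \<and> U \<noteq> {} \<and> U \<subseteq> {t0<..<t1}) \<and> (V \<noteq> {} \<and> V \<subseteq> {..<n}) \<and>
    (\<forall>t\<in>U. \<forall>i<n. p i t \<noteq> 0 \<longleftrightarrow> i \<in> V)"
    by (rule stable_support[where p = p, OF \<open>t0 < t1\<close> _ \<open>i < n\<close> \<open>p i t1 \<noteq> 0\<close>]) (rule p)
  then obtain U V where UV: "(open U \<and> U \<noteq> {} \<and> U \<subseteq> {t0<..<t1}) \<and> (V \<noteq> {} \<and> V \<subseteq> {..<n}) \<and>
    (\<forall>t\<in>U. \<forall>i<n. p i t \<noteq> 0 \<longleftrightarrow> i \<in> V)"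
    by (elim exE) (rule that)
  have U: "open U" "U \<noteq> {}" "U \<subseteq> {t0<..<t1}"
    using conjunct1[OF UV] by simp_all
  have V: "V \<noteq> {}" "V \<subseteq> {..<n}"
    using conjunct1[OF conjunct2[OF UV]] by simp_all
  have supp: "p i t \<noteq> 0 \<longleftrightarrow> i \<in> V" if "t \<in> U" "i < n" for t i
    using conjunct2[OF conjunct2[OF UV]] that by blast
  have "\<exists>v. (v < n + r \<and> v \<notin> V) \<and> (\<exists>!w. w \<in> V \<and> edge v w)"
    using G[unfolded sole_successor_property_def, rule_format, of V] V by simp
  then obtain v where v0: "(v < n + r \<and> v \<notin> V) \<and> (\<exists>!w. w \<in> V \<and> edge v w)"
    by (rule exE) (rule that)
  then have v: "v < n + r" "v \<notin> V" by simp_all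
  from conjunct2[OF v0] obtain w where w0: "w \<in> V \<and> edge v w" "\<forall>w'. w' \<in> V \<and> edge v w' \<longrightarrow> w' = w"
    by (rule ex1E) (rule that)
  note w = conjunct1[OF w0(1)] conjunct2[OF w0(1)] w0(2)[rule_format, OF conjI]
  define f where "f j t = (if v < n then a j v t else b j (v - n) t)" for j t
  have f_edge: "AE t in lebesgue. \<forall>j<n. f j t \<noteq> 0 \<longleftrightarrow> edge v j"
    using a b
  proof eventually_elim
    case (elim t)
    show ?case
    proof (cases "v < n")
      case False
      then have "v - n < r" "n + (v - n) = v" using v(1) by auto
      then show ?thesis using elim(2) False unfolding f_def by metis
    qed (use elim(1) in \<open>auto simp: f_def\<close>)
  qed
  \<comment> \<open>for a state vertex \<open>v\<close> the component \<open>p v\<close> vanishes on \<open>U\<close>, and so does its derivative\<close>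
  have f_0: "AE t in lebesgue. t \<in> U \<longrightarrow> (\<Sum>j<n. f j t * p j t) = 0"
  proof (cases "v < n")
    case True
    show ?thesis
      using dp
    proof eventually_elim
      case (elim t)
      show ?case
      proof
        assume t: "t \<in> U"
        then have "t \<in> {t0<..<t1}" using U(3) by blast
        then have "(p v has_vector_derivative - (\<Sum>j<n. a j v t * p j t)) (at t)"
          using elim True at_within_Icc_at[of t0 t t1] by auto
        moreover have "(p v has_vector_derivative 0) (at t)"
          by (rule has_vector_derivative_transform_within_open[OF has_vector_derivative_const[of 0] U(1) t])
             (use supp True v(2) in auto)
        ultimately have "- (\<Sum>j<n. a j v t * p j t) = 0" by (rule vector_derivative_unique_at)
        then show "(\<Sum>j<n. f j t * p j t) = 0" using True by (simp add: f_def)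
      qed
    qed
  next
    case False
    then have "v - n < r" using v(1) by auto
    from pb[OF this] show ?thesis
      by eventually_elim (use U(3) False in \<open>auto simp: f_def mult.commute\<close>)
  qed
  have "AE t in lebesgue. t \<notin> U"
    using f_edge f_0
  proof eventually_elim
    case (elim t)
    show ?case
    proof
      assume t: "t \<in> U"
      have "(\<Sum>j<n. f j t * p j t) = (\<Sum>j<n. if j = w then f w t * p w t else 0)"
      proof (rule sum.cong[OF refl])
        fix j assume "j \<in> {..<n}"
        then show "f j t * p j t = (if j = w then f w t * p w t else 0)"
          using elim(1) supp[OF t, of j] w(3)[of j] by auto
      qed
      also have "\<dots> = f w t * p w t" using w(1) V(2) by auto
      finally have "f w t * p w t = 0" using elim(2) t by simp
      then show False using elim(1) supp[OF t, of w] w(1,2) V(2) by auto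
    qed
  qed
  then have "negligible U"
    unfolding eventually_ae_filter_negligible by (auto intro: negligible_subset)
  then show False using U(1,2) open_not_negligible by blast
qed

section \<open>Uncontrollable systems\<close>

lemma abs_continuous_on_exp_scaleR:
  fixes q :: "'a::real_normed_vector"
  shows "abs_continuous_on {a..b} (\<lambda>t. exp (m * t) *\<^sub>R q)"
proof -
  have "abs_continuous_on {a..b} (\<lambda>t::real. t)"
  proof (rule primitive_abs_continuous_on[where f = "\<lambda>t. 1" and c = a])
    show "locally_integrable (\<lambda>t::real. 1::real)"
      unfolding locally_integrable_def
      by (auto intro!: absolutely_integrable_continuous_real continuous_intros)
  qed auto
  then have "abs_continuous_on {a..b} (\<lambda>t. exp (m * t))"
    by (intro abs_continuous_on_exp abs_continuous_on_mult abs_continuous_on_const)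
  then show ?thesis
  proof (rule abs_continuous_on_dominated[OF _ abs_continuous_on_const[of _ "0::real"]])
    show "norm (exp (m * t) *\<^sub>R q - exp (m * s) *\<^sub>R q) \<le> norm q * (norm (exp (m * t) - exp (m * s)) + norm (0 - 0 :: real))" for s t
      by (simp add: scaleR_left_diff_distrib[symmetric] mult.commute)
  qed
qed

lemma mult_mat_vec_sum:
  assumes "M \<in> carrier_mat n m" "y \<in> carrier_vec m" "i < n"
  shows "(M *\<^sub>v y) $ i = (\<Sum>j<m. M $$ (i, j) * y $ j)"
  using assms by (auto simp: scalar_prod_def lessThan_atLeast0 intro!: sum.cong)

text \<open>A costate that no input can influence forces \<open>p\<^sup>T x\<close> to be constant, hence 0 for solutions starting
  at 0; at a unit vector with \<open>q l \<noteq> 0\<close> it is nonzero at all times.  The exponents \<open>m i\<close> may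
  differ because an exponentially scaled system is a time-invariant one in scaled coordinates.\<close>

lemma exponential_costate_not_controlled:
  fixes A B :: "real \<Rightarrow> 'a::{real_normed_field, euclidean_space} mat"
  assumes A: "\<And>t. A t \<in> carrier_mat n n" and B: "\<And>t. B t \<in> carrier_mat n r"
    and adj: "\<And>i t. i < n \<Longrightarrow> (\<Sum>j<n. A t $$ (j, i) * (exp (m j * t) *\<^sub>R q j)) = - (m i *\<^sub>R (exp (m i * t) *\<^sub>R q i))"
    and ann: "\<And>k t. k < r \<Longrightarrow> (\<Sum>i<n. (exp (m i * t) *\<^sub>R q i) * B t $$ (i, k)) = 0"
    and "l < n" "q l \<noteq> 0"
  shows "\<not> can_be_controlled n r A B \<tau>0 (0\<^sub>v n) \<tau>1 (unit_vec n l)"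
proof
  assume "can_be_controlled n r A B \<tau>0 (0\<^sub>v n) \<tau>1 (unit_vec n l)"
  then obtain u x where "\<tau>0 \<le> \<tau>1" and u: "input_signal r u" and x: "solution n A B \<tau>0 u x"
    and x0: "x \<tau>0 = 0\<^sub>v n" and x1: "x \<tau>1 = unit_vec n l"
    unfolding can_be_controlled_def by blast
  define p where "p i t = exp (m i * t) *\<^sub>R q i" for i t
  define v where "v i t = (\<Sum>k<r. B t $$ (i, k) * u t $ k)" for i t
  have "((\<lambda>t. \<Sum>i<n. p i t * v i t) has_integral
      (\<Sum>i<n. p i \<tau>1 * x \<tau>1 $ i) - (\<Sum>i<n. p i \<tau>0 * x \<tau>0 $ i)) {\<tau>0..\<tau>1}"
  proof (rule costate_state_pairing[OF \<open>\<tau>0 \<le> \<tau>1\<close>, where a = "\<lambda>i j t. A t $$ (i, j)"])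
    show "abs_continuous_on {\<tau>0..\<tau>1} (p i)" for i
      unfolding p_def[abs_def] by (rule abs_continuous_on_exp_scaleR)
    show "abs_continuous_on {\<tau>0..\<tau>1} (\<lambda>t. x t $ i)" if "i < n" for i
      using x \<open>\<tau>0 \<le> \<tau>1\<close> that unfolding solution_def by blast
    show "AE t in lebesgue. t \<in> {\<tau>0..\<tau>1} \<longrightarrow>
      (\<forall>i<n. (p i has_vector_derivative - (\<Sum>j<n. A t $$ (j, i) * p j t)) (at t within {\<tau>0..\<tau>1}))"
    proof (intro AE_I2 impI allI)
      fix t i assume "i < n"
      have "((\<lambda>t. exp (m i * t)) has_field_derivative m i * exp (m i * t)) (at t within {\<tau>0..\<tau>1})"
        by (auto intro!: derivative_eq_intros)
      then have "(p i has_vector_derivative (m i * exp (m i * t)) *\<^sub>R q i) (at t within {\<tau>0..\<tau>1})"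
        unfolding p_def[abs_def] has_real_derivative_iff_has_vector_derivative
        by (rule bounded_linear.has_vector_derivative[OF bounded_linear_scaleR_left])
      also have "(m i * exp (m i * t)) *\<^sub>R q i = - (\<Sum>j<n. A t $$ (j, i) * p j t)"
        using adj[OF \<open>i < n\<close>, of t] by (simp add: p_def)
      finally show "(p i has_vector_derivative - (\<Sum>j<n. A t $$ (j, i) * p j t)) (at t within {\<tau>0..\<tau>1})" .
    qed
    have "AE t in lebesgue. t \<ge> \<tau>0 \<longrightarrow> (\<forall>i<n. ((\<lambda>s. x s $ i) has_vector_derivative
        (A t *\<^sub>v x t + B t *\<^sub>v u t) $ i) (at t within {\<tau>0..}))"
      using x unfolding solution_def by blast
    then show "AE t in lebesgue. t \<in> {\<tau>0..\<tau>1} \<longrightarrow> (\<forall>i<n. ((\<lambda>s. x s $ i) has_vector_derivative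
        (\<Sum>j<n. A t $$ (i, j) * x t $ j) + v i t) (at t within {\<tau>0..\<tau>1}))"
    proof eventually_elim
      case (elim t)
      show ?case
      proof (intro impI allI)
        fix i assume t: "t \<in> {\<tau>0..\<tau>1}" and i: "i < n"
        have xt: "x t \<in> carrier_vec n" using x t by (simp add: solution_def)
        have ut: "u t \<in> carrier_vec r" using u by (simp add: input_signal_def)
        have "(A t *\<^sub>v x t + B t *\<^sub>v u t) $ i = (A t *\<^sub>v x t) $ i + (B t *\<^sub>v u t) $ i"
          using B[of t] i by (intro index_add_vec(1)) simp
        also have "\<dots> = (\<Sum>j<n. A t $$ (i, j) * x t $ j) + v i t"
          using mult_mat_vec_sum[OF A xt i] mult_mat_vec_sum[OF B ut i] by (simp add: v_def)
        finally have eq: "(A t *\<^sub>v x t + B t *\<^sub>v u t) $ i = (\<Sum>j<n. A t $$ (i, j) * x t $ j) + v i t" .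
        have "((\<lambda>s. x s $ i) has_vector_derivative (A t *\<^sub>v x t + B t *\<^sub>v u t) $ i) (at t within {\<tau>0..})"
          using elim[rule_format, OF _ i] t by (simp only: atLeastAtMost_iff)
        then have "((\<lambda>s. x s $ i) has_vector_derivative (\<Sum>j<n. A t $$ (i, j) * x t $ j) + v i t) (at t within {\<tau>0..})"
          unfolding eq .
        then show "((\<lambda>s. x s $ i) has_vector_derivative (\<Sum>j<n. A t $$ (i, j) * x t $ j) + v i t) (at t within {\<tau>0..\<tau>1})"
          by (rule has_vector_derivative_within_subset) auto
      qed
    qed
  qed
  moreover have "(\<Sum>i<n. p i t * v i t) = 0" for t
  proof -
    have "(\<Sum>i<n. p i t * v i t) = (\<Sum>k<r. (\<Sum>i<n. p i t * B t $$ (i, k)) * u t $ k)"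
      unfolding v_def sum_distrib_left sum_distrib_right by (subst sum.swap) (simp add: mult.assoc)
    also have "\<dots> = 0" using ann[of _ t] by (simp add: p_def)
    finally show ?thesis .
  qed
  moreover have "(\<Sum>i<n. p i \<tau>0 * x \<tau>0 $ i) = 0" by (simp add: x0)
  moreover have "(\<Sum>i<n. p i \<tau>1 * x \<tau>1 $ i) = p l \<tau>1"
  proof -
    have "(\<Sum>i<n. p i \<tau>1 * x \<tau>1 $ i) = (\<Sum>i<n. if i = l then p l \<tau>1 else 0)"
      by (rule sum.cong) (use \<open>l < n\<close> in \<open>auto simp: x1\<close>)
    then show ?thesis using \<open>l < n\<close> by simp
  qed
  ultimately have "((\<lambda>t. 0) has_integral p l \<tau>1) {\<tau>0..\<tau>1}" by simp
  then have "p l \<tau>1 = 0" by simp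
  then show False using \<open>q l \<noteq> 0\<close> by (simp add: p_def)
qed

text \<open>With at least two summands available, one of them can balance the others.\<close>

lemma exists_nonzero_weights_sum_0:
  assumes "finite S" "card S \<noteq> 1"
  shows "\<exists>g. (\<forall>w\<in>S. g w \<noteq> 0) \<and> (\<Sum>w\<in>S. g w) = (0 :: 'a::field_char_0)"
proof (cases "S = {}")
  case False
  then obtain w0 where w0: "w0 \<in> S" by blast
  have "card S \<noteq> 0" using assms(1) False by simp
  with assms(2) have "card S - 1 \<noteq> 0" by linarith
  then have "- of_nat (card S - 1) \<noteq> (0 :: 'a)" by (simp only: neg_equal_0_iff_equal of_nat_eq_0_iff simp_thms)
  moreover have "(\<Sum>w\<in>S. if w = w0 then - of_nat (card S - 1) else 1) = (0 :: 'a)"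
    using assms(1) w0 by (simp add: sum.remove[of S w0] card_Diff_singleton)
  ultimately show ?thesis by (intro exI[of _ "\<lambda>w. if w = w0 then - of_nat (card S - 1) else 1"]) auto
qed auto

text \<open>\<open>V\<close> violates the graph condition; \<open>h v w\<close> will be the entry of a matrix in column \<open>v\<close> and row \<open>w\<close>.
  Columns outside \<open>V\<close> have sum 0 over the rows in \<open>V\<close>; the values 1 in the columns of \<open>V\<close> make their
  sums a matter of counting.\<close>

lemma not_sole_successor_weights:
  assumes "\<not> sole_successor_property n r edge"
  obtains V and h :: "nat \<Rightarrow> nat \<Rightarrow> 'a::field_char_0"
  where "V \<noteq> {}" "V \<subseteq> {..<n}" "\<And>v w. h v w \<noteq> 0 \<longleftrightarrow> edge v w"
    "\<And>v. v < n + r \<Longrightarrow> v \<notin> V \<Longrightarrow> (\<Sum>w\<in>V. h v w) = 0"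
    "\<And>v w. v \<in> V \<Longrightarrow> h v w = (if edge v w then 1 else 0)"
proof -
  obtain V where V: "V \<noteq> {}" "V \<subseteq> {..<n}" "\<And>v. v < n + r \<Longrightarrow> v \<notin> V \<Longrightarrow> \<not> (\<exists>!w. w \<in> V \<and> edge v w)"
  proof -
    have "\<exists>V. (V \<noteq> {} \<and> V \<subseteq> {..<n}) \<and> \<not> (\<exists>v<n + r. v \<notin> V \<and> (\<exists>!w. w \<in> V \<and> edge v w))"
      using assms unfolding sole_successor_property_def by (simp only: not_all not_imp)
    then obtain V where "(V \<noteq> {} \<and> V \<subseteq> {..<n}) \<and> \<not> (\<exists>v<n + r. v \<notin> V \<and> (\<exists>!w. w \<in> V \<and> edge v w))"
      by (rule exE) (rule that)
    then show thesis by (intro that[of V]) (simp_all only: not_ex simp_thms de_Morgan_conj not_False_eq_True, auto)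
  qed
  have "finite V" using V(2) by (rule finite_subset) simp
  define S where "S v = {w \<in> V. edge v w}" for v
  have fin: "finite (S v)" for v using \<open>finite V\<close> by (simp add: S_def)
  have card: "card (S v) \<noteq> 1" if "v < n + r" "v \<notin> V" for v
  proof
    assume "card (S v) = 1"
    then obtain w where "S v = {w}" by (rule card_1_singletonE)
    then have "\<exists>!w. w \<in> V \<and> edge v w" unfolding S_def by (intro ex1I[of _ w]) auto
    then show False using V(3)[OF that] by simp
  qed
  have "\<exists>g. \<forall>v. v < n + r \<and> v \<notin> V \<longrightarrow> (\<forall>w\<in>S v. g v w \<noteq> (0::'a)) \<and> (\<Sum>w\<in>S v. g v w) = 0"
    by (rule choice) (use exists_nonzero_weights_sum_0[OF fin card] in blast)
  then obtain g where g: "\<forall>v. v < n + r \<and> v \<notin> V \<longrightarrow> (\<forall>w\<in>S v. g v w \<noteq> (0::'a)) \<and> (\<Sum>w\<in>S v. g v w) = 0"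
    by (rule exE) (rule that)
  define h where "h v w = (if edge v w then if v < n + r \<and> v \<notin> V \<and> w \<in> V then g v w else 1 else 0)" for v w
  show thesis
  proof (rule that[OF V(1,2), of h])
    show "h v w \<noteq> 0 \<longleftrightarrow> edge v w" for v w using g by (auto simp: h_def S_def)
    show "(\<Sum>w\<in>V. h v w) = 0" if v: "v < n + r" "v \<notin> V" for v
    proof -
      have "(\<Sum>w\<in>V. h v w) = (\<Sum>w\<in>S v. h v w)"
        by (rule sum.mono_neutral_right) (use \<open>finite V\<close> in \<open>auto simp: S_def h_def\<close>)
      also have "\<dots> = (\<Sum>w\<in>S v. g v w)" by (rule sum.cong) (use v in \<open>auto simp: S_def h_def\<close>)
      finally show ?thesis using g v by simp
    qed
    show "h v w = (if edge v w then 1 else 0)" if "v \<in> V" for v w using that by (simp add: h_def)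
  qed
qed

lemma mat_exp_mat_diag:
  fixes f :: "nat \<Rightarrow> 'a::{real_normed_field, euclidean_space}"
  shows "mat_exp (mat_diag n f) = mat_diag n (\<lambda>i. exp (f i))"
proof -
  have pow: "mat_diag n f ^\<^sub>m k = mat_diag n (\<lambda>i. f i ^ k)" for k
    by (induction k) (simp_all add: power_commutes mat_diag_def[of n f, THEN arg_cong[of _ _ dim_row]])
  have "mat_exp (mat_diag n f) $$ (i, j) = mat_diag n (\<lambda>i. exp (f i)) $$ (i, j)" if "i < n" "j < n" for i j
  proof (cases "i = j")
    case True
    have "mat_exp (mat_diag n f) $$ (i, j) = (\<Sum>k. f i ^ k /\<^sub>R fact k)"
      using that True unfolding mat_exp_def pow by (simp add: mat_diag_def)
    then show ?thesis using that True by (simp add: exp_def mat_diag_def)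
  next
    case False
    then show ?thesis using that unfolding mat_exp_def pow by (simp add: mat_diag_def)
  qed
  then show ?thesis by (intro eq_matI) (auto simp: mat_exp_def mat_diag_def)
qed

text \<open>The scaling matrix is \<open>\<Lambda> = diag m\<close>.  Its diagonal is added to the diagonal of \<open>A0\<close>, which gives the
  columns of \<open>A0\<close> in \<open>V\<close> the sum 0 over the rows in \<open>V\<close>; subtracting \<open>\<Lambda>\<close> in the definition of
  \<open>A(t)\<close> restores the zero pattern on the diagonal.\<close>

lemma exponentially_scaled_uncontrollable:
  assumes "\<not> sole_successor_property n r edge"
  shows "\<exists>A B x0 x1. exponentially_scaled n r A B \<and> ct_system n r A B \<and>
    (\<forall>t. (\<forall>i<n. \<forall>j<n. A t $$ (i, j) \<noteq> 0 \<longleftrightarrow> edge j i) \<and> (\<forall>i<n. \<forall>k<r. B t $$ (i, k) \<noteq> 0 \<longleftrightarrow> edge (n + k) i)) \<and>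
    x0 \<in> carrier_vec n \<and> x1 \<in> carrier_vec n \<and>
    (\<forall>\<tau>0 \<tau>1. \<not> can_be_controlled n r A (B :: real \<Rightarrow> 'a::{real_normed_field, euclidean_space} mat) \<tau>0 x0 \<tau>1 x1)"
proof -
  obtain V and h :: "nat \<Rightarrow> nat \<Rightarrow> 'a" where V: "V \<noteq> {}" "V \<subseteq> {..<n}"
    and h: "\<And>v w. h v w \<noteq> 0 \<longleftrightarrow> edge v w"
    and out: "\<And>v. v < n + r \<Longrightarrow> v \<notin> V \<Longrightarrow> (\<Sum>w\<in>V. h v w) = 0"
    and ins: "\<And>v w. v \<in> V \<Longrightarrow> h v w = (if edge v w then 1 else 0)"
    by (rule not_sole_successor_weights[OF assms]) (rule that)
  have finV: "finite V" using V(2) by (rule finite_subset) simp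
  define m where "m v = (if v \<in> V then - real (card {w \<in> V. edge v w}) else 0)" for v
  define L where "L = mat_diag n (\<lambda>i. of_real (m i) :: 'a)"
  define A0 where "A0 = Matrix.mat n n (\<lambda>(i, j). h j i + (if i = j then of_real (m i) else 0))"
  define B0 where "B0 = Matrix.mat n r (\<lambda>(i, k). h (n + k) i)"
  define A where "A t = mat_exp (of_real (- t) \<cdot>\<^sub>m L) * A0 * mat_exp (of_real t \<cdot>\<^sub>m L) - L" for t
  define B where "B t = mat_exp (of_real (- t) \<cdot>\<^sub>m L) * B0" for t
  have exp_L: "mat_exp (of_real s \<cdot>\<^sub>m L) = mat_diag n (\<lambda>i. of_real (exp (s * m i)))" for s
  proof -
    have "of_real s \<cdot>\<^sub>m L = mat_diag n (\<lambda>i. of_real (s * m i))"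
      by (rule eq_matI) (auto simp: L_def mat_diag_def)
    then show ?thesis by (simp only: mat_exp_mat_diag exp_of_real)
  qed
  have car: "L \<in> carrier_mat n n" "A0 \<in> carrier_mat n n" "B0 \<in> carrier_mat n r"
    by (simp_all add: L_def A0_def B0_def)
  have A_eq: "A t = Matrix.mat n n (\<lambda>(i, j). of_real (exp ((m j - m i) * t)) * h j i)" for t
  proof -
    have "A t $$ (i, j) = of_real (exp ((m j - m i) * t)) * h j i" if "i < n" "j < n" for i j
    proof -
      have "A t $$ (i, j) = of_real (exp (- t * m i)) * A0 $$ (i, j) * of_real (exp (t * m j)) - L $$ (i, j)"
        unfolding A_def exp_L mat_diag_mult_left[OF car(2)]
        by (subst mat_diag_mult_right[of _ n]) (use that in \<open>auto simp: L_def mat_diag_def\<close>)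
      also have "\<dots> = of_real (exp (- t * m i) * exp (t * m j)) * h j i"
        using that by (cases "i = j") (auto simp: A0_def L_def mat_diag_def algebra_simps exp_minus_inverse simp flip: of_real_mult exp_add)
      also have "exp (- t * m i) * exp (t * m j) = exp ((m j - m i) * t)"
        by (simp add: exp_add[symmetric] algebra_simps)
      finally show ?thesis .
    qed
    then show ?thesis using car by (intro eq_matI) (auto simp: A_def exp_L)
  qed
  have B_eq: "B t = Matrix.mat n r (\<lambda>(i, k). of_real (exp (- (m i * t))) * h (n + k) i)" for t
    unfolding B_def exp_L mat_diag_mult_left[OF car(3)]
    by (rule eq_matI) (auto simp: B0_def mult.commute)
  have sum_V: "(\<Sum>j<n. if j \<in> V then f j else 0) = (\<Sum>j\<in>V. f j)" for f :: "nat \<Rightarrow> 'a"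
    using V(2) by (simp add: sum.inter_restrict[symmetric] Int_absorb1 flip: sum.inter_restrict)
  obtain l where l: "l \<in> V" "l < n" using V by blast
  have "exponentially_scaled n r A B"
    unfolding exponentially_scaled_def A_def B_def
    by (intro bexI[of _ L] bexI[of _ A0] bexI[of _ B0] conjI allI car)
       (auto simp: diagonal_mat_def L_def mat_diag_def)
  moreover have "ct_system n r A B"
    unfolding ct_system_def locally_integrable_def A_eq B_eq
    by (auto intro!: absolutely_integrable_continuous_real continuous_intros)
  moreover have "\<forall>t. (\<forall>i<n. \<forall>j<n. A t $$ (i, j) \<noteq> 0 \<longleftrightarrow> edge j i) \<and> (\<forall>i<n. \<forall>k<r. B t $$ (i, k) \<noteq> 0 \<longleftrightarrow> edge (n + k) i)"
    using h by (auto simp: A_eq B_eq)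
  moreover have "\<not> can_be_controlled n r A B \<tau>0 (0\<^sub>v n) \<tau>1 (unit_vec n l)" for \<tau>0 \<tau>1
  proof (rule exponential_costate_not_controlled[where m = m and q = "\<lambda>i. if i \<in> V then 1 else 0"])
    show "A t \<in> carrier_mat n n" "B t \<in> carrier_mat n r" for t by (simp_all add: A_eq B_eq)
    fix t i assume i: "i < n"
    have "(\<Sum>j<n. A t $$ (j, i) * (exp (m j * t) *\<^sub>R (if j \<in> V then 1 else 0)))
        = (\<Sum>j<n. if j \<in> V then of_real (exp (m i * t)) * h i j else 0)"
      using i by (intro sum.cong)
        (auto simp: A_eq scaleR_conv_of_real algebra_simps simp flip: of_real_mult exp_add)
    also have "\<dots> = of_real (exp (m i * t)) * (\<Sum>j\<in>V. h i j)"
      unfolding sum_V by (simp add: sum_distrib_left)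
    also have "\<dots> = - (m i *\<^sub>R (exp (m i * t) *\<^sub>R (if i \<in> V then 1 else 0)))"
    proof (cases "i \<in> V")
      case True
      then have "(\<Sum>j\<in>V. h i j) = of_nat (card {w \<in> V. edge i w})"
        using finV by (simp add: ins sum.If_cases Int_def)
      then show ?thesis using True by (simp add: m_def scaleR_conv_of_real mult.commute)
    qed (use out[of i] i in simp)
    finally show "(\<Sum>j<n. A t $$ (j, i) * (exp (m j * t) *\<^sub>R (if j \<in> V then 1 else 0)))
        = - (m i *\<^sub>R (exp (m i * t) *\<^sub>R (if i \<in> V then 1 else 0)))" .
  next
    fix k t assume k: "k < r"
    have "(\<Sum>i<n. exp (m i * t) *\<^sub>R (if i \<in> V then 1 else 0) * B t $$ (i, k)) = (\<Sum>i<n. if i \<in> V then h (n + k) i else 0)"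
      using k by (intro sum.cong) (auto simp: B_eq scaleR_conv_of_real exp_minus)
    also have "\<dots> = 0" unfolding sum_V using out[of "n + k"] k V(2) by auto
    finally show "(\<Sum>i<n. exp (m i * t) *\<^sub>R (if i \<in> V then 1 else 0) * B t $$ (i, k)) = 0" .
  qed (use l in auto)
  ultimately show ?thesis
    by (intro exI[of _ A] exI[of _ B] exI[of _ "0\<^sub>v n"] exI[of _ "unit_vec n l"]) auto
qed

text \<open>The diagonal entries in the columns of \<open>V\<close> are chosen such that the indicator vector of \<open>V\<close> is a left
  eigenvector with eigenvalue \<open>-1\<close>.  A negative eigenvalue keeps these entries away from 0, also if
  there is nothing else in the column to be balanced.\<close>

lemma time_invariant_uncontrollable:
  assumes "\<not> sole_successor_property n r edge"
  shows "\<exists>A B x0 x1. A \<in> carrier_mat n n \<and> B \<in> carrier_mat n r \<and>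
    (\<forall>i<n. \<forall>j<n. A $$ (i, j) \<noteq> 0 \<longleftrightarrow> i = j \<or> edge j i) \<and> (\<forall>i<n. \<forall>k<r. B $$ (i, k) \<noteq> 0 \<longleftrightarrow> edge (n + k) i) \<and>
    x0 \<in> carrier_vec n \<and> x1 \<in> carrier_vec n \<and>
    (\<forall>\<tau>0 \<tau>1. \<not> can_be_controlled n r (\<lambda>t. A) (\<lambda>t. B :: 'a::{real_normed_field, euclidean_space} mat) \<tau>0 x0 \<tau>1 x1)"
proof -
  obtain V and h :: "nat \<Rightarrow> nat \<Rightarrow> 'a" where V: "V \<noteq> {}" "V \<subseteq> {..<n}"
    and h: "\<And>v w. h v w \<noteq> 0 \<longleftrightarrow> edge v w"
    and out: "\<And>v. v < n + r \<Longrightarrow> v \<notin> V \<Longrightarrow> (\<Sum>w\<in>V. h v w) = 0"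
    and ins: "\<And>v w. v \<in> V \<Longrightarrow> h v w = (if edge v w then 1 else 0)"
    by (rule not_sole_successor_weights[OF assms]) (rule that)
  have finV: "finite V" using V(2) by (rule finite_subset) simp
  define c where "c v = card {w \<in> V - {v}. edge v w}" for v
  define A where "A = Matrix.mat n n (\<lambda>(i, j). if i \<noteq> j then h j i else if i \<in> V then - of_nat (Suc (c i)) else 1)"
  define B where "B = Matrix.mat n r (\<lambda>(i, k). h (n + k) i)"
  have sum_V: "(\<Sum>j<n. if j \<in> V then f j else 0) = (\<Sum>j\<in>V. f j)" for f :: "nat \<Rightarrow> 'a"
    using V(2) by (simp add: sum.inter_restrict[symmetric] Int_absorb1 flip: sum.inter_restrict)
  obtain l where l: "l \<in> V" "l < n" using V by blast
  have nz: "- of_nat (Suc k) \<noteq> (0 :: 'a)" for k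
    by (simp only: neg_equal_0_iff_equal of_nat_eq_0_iff)
  have "\<forall>i<n. \<forall>j<n. A $$ (i, j) \<noteq> 0 \<longleftrightarrow> i = j \<or> edge j i"
    using h nz by (auto simp: A_def simp del: of_nat_Suc)
  moreover have "\<forall>i<n. \<forall>k<r. B $$ (i, k) \<noteq> 0 \<longleftrightarrow> edge (n + k) i"
    using h by (auto simp: B_def)
  moreover have "\<not> can_be_controlled n r (\<lambda>t. A) (\<lambda>t. B) \<tau>0 (0\<^sub>v n) \<tau>1 (unit_vec n l)" for \<tau>0 \<tau>1
  proof (rule exponential_costate_not_controlled[where m = "\<lambda>i. 1" and q = "\<lambda>i. if i \<in> V then 1 else 0"])
    show "A \<in> carrier_mat n n" "B \<in> carrier_mat n r" by (simp_all add: A_def B_def)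
    fix t i assume i: "i < n"
    have "(\<Sum>j<n. A $$ (j, i) * (exp (1 * t) *\<^sub>R (if j \<in> V then 1 else 0)))
        = (\<Sum>j<n. if j \<in> V then of_real (exp t) * A $$ (j, i) else 0)"
      by (intro sum.cong) (auto simp: scaleR_conv_of_real mult.commute)
    also have "\<dots> = of_real (exp t) * (\<Sum>j\<in>V. A $$ (j, i))"
      unfolding sum_V by (simp add: sum_distrib_left)
    also have "(\<Sum>j\<in>V. A $$ (j, i)) = (if i \<in> V then - 1 else 0)"
    proof (cases "i \<in> V")
      case True
      have "(\<Sum>j\<in>V. A $$ (j, i)) = - of_nat (Suc (c i)) + (\<Sum>j\<in>V - {i}. h i j)"
      proof -
        have "(\<Sum>j\<in>V. A $$ (j, i)) = A $$ (i, i) + (\<Sum>j\<in>V - {i}. A $$ (j, i))"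
          by (rule sum.remove[OF finV True])
        also have "A $$ (i, i) = - of_nat (Suc (c i))" using True i by (simp add: A_def)
        also have "(\<Sum>j\<in>V - {i}. A $$ (j, i)) = (\<Sum>j\<in>V - {i}. h i j)"
        proof (rule sum.cong[OF refl])
          fix j assume "j \<in> V - {i}"
          then show "A $$ (j, i) = h i j" using V(2) i by (auto simp: A_def subset_iff)
        qed
        finally show ?thesis .
      qed
      also have "(\<Sum>j\<in>V - {i}. h i j) = of_nat (c i)"
        using finV True by (simp add: ins sum.If_cases Int_def c_def)
      finally show ?thesis using True by simp
    next
      case False
      have "(\<Sum>j\<in>V. A $$ (j, i)) = (\<Sum>j\<in>V. h i j)"
        using False i V(2) by (intro sum.cong) (auto simp: A_def)
      then show ?thesis using False out[of i] i by simp
    qed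
    finally show "(\<Sum>j<n. A $$ (j, i) * (exp (1 * t) *\<^sub>R (if j \<in> V then 1 else 0)))
        = - (1 *\<^sub>R (exp (1 * t) *\<^sub>R (if i \<in> V then 1 else 0)))"
      by (simp add: scaleR_conv_of_real)
  next
    fix k t assume k: "k < r"
    have "(\<Sum>i<n. exp (1 * t) *\<^sub>R (if i \<in> V then 1 else 0) * B $$ (i, k)) = (\<Sum>i<n. if i \<in> V then of_real (exp t) * h (n + k) i else 0)"
      using k by (intro sum.cong) (auto simp: B_def scaleR_conv_of_real)
    also have "\<dots> = of_real (exp t) * (\<Sum>i\<in>V. h (n + k) i)" unfolding sum_V by (simp add: sum_distrib_left)
    also have "\<dots> = 0" using out[of "n + k"] k V(2) by auto
    finally show "(\<Sum>i<n. exp (1 * t) *\<^sub>R (if i \<in> V then 1 else 0) * B $$ (i, k)) = 0" .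
  qed (use l in auto)
  ultimately show ?thesis
    by (intro exI[of _ A] exI[of _ B] exI[of _ "0\<^sub>v n"] exI[of _ "unit_vec n l"]) (auto simp: A_def B_def)
qed

section \<open>Patterns of matrices\<close>

text \<open>Passage from component functions to vector-valued signals.  The derivative on the half-line is
  obtained from countably many compact intervals, each with its own exceptional null set.\<close>

lemma ct_system_controllable_on:
  fixes A B :: "real \<Rightarrow> 'a::{real_normed_field, euclidean_space} mat"
  assumes sys: "ct_system n r A B" and "t0 < t1" and G: "sole_successor_property n r edge"
    and A: "AE t in lebesgue. \<forall>i<n. \<forall>j<n. A t $$ (i, j) \<noteq> 0 \<longleftrightarrow> edge j i"
    and B: "AE t in lebesgue. \<forall>i<n. \<forall>k<r. B t $$ (i, k) \<noteq> 0 \<longleftrightarrow> edge (n + k) i"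
  shows "controllable_on n r A B t0 t1"
  unfolding controllable_on_def
proof (intro ballI)
  fix x0 x1 :: "'a vec" assume x0: "x0 \<in> carrier_vec n" and x1: "x1 \<in> carrier_vec n"
  interpret linear_control_system n r "\<lambda>i j t. A t $$ (i, j)" "\<lambda>i k t. B t $$ (i, k)"
    by standard (use sys in \<open>auto simp: ct_system_def\<close>)
  have "\<exists>u x. trajectory t0 (\<lambda>i. x0 $ i) u x \<and> (\<forall>i<n. x i t1 = x1 $ i)"
  proof (rule controllable_if_observable)
    show "t0 \<le> t1" using \<open>t0 < t1\<close> by simp
    fix p
    assume p: "costate t0 t1 p"
      and pb: "\<And>k. k < r \<Longrightarrow> AE t in lebesgue. t \<in> {t0..t1} \<longrightarrow> (\<Sum>i<n. p i t * B t $$ (i, k)) = 0"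
    have dp: "AE t in lebesgue. t \<in> {t0..t1} \<longrightarrow>
      (\<forall>i<n. (p i has_vector_derivative - (\<Sum>j<n. A t $$ (j, i) * p j t)) (at t within {t0..t1}))"
      using p unfolding costate_def by (rule conjunct2)
    have p_cont: "continuous_on {t0..t1} (p i)" if "i < n" for i
      using p that unfolding costate_def by (intro abs_continuous_on_imp_continuous_on) blast
    show "\<forall>i<n. p i t1 = 0"
    proof (intro allI impI)
      fix i assume "i < n"
      show "p i t1 = 0"
        by (rule sole_successor_costate_eq_0[where a = "\<lambda>i j t. A t $$ (i, j)" and b = "\<lambda>i k t. B t $$ (i, k)",
              OF \<open>t0 < t1\<close> G A B p_cont dp pb \<open>i < n\<close>])
    qed
  qed
  then obtain u x where ux: "trajectory t0 (\<lambda>i. x0 $ i) u x \<and> (\<forall>i<n. x i t1 = x1 $ i)"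
    by (elim exE) (rule that)
  note x = conjunct1[OF ux]
  have u: "bounded_input r u" using x by (simp add: trajectory_def)
  define U where "U t = Matrix.vec r (\<lambda>k. u k t)" for t
  define X where "X t = Matrix.vec n (\<lambda>i. x i t)" for t
  have "input_signal r U"
    unfolding input_signal_def
  proof (intro conjI allI impI)
    fix k assume k: "k < r"
    show "(\<lambda>t. U t $ k) \<in> borel_measurable lebesgue" using u k by (simp add: U_def bounded_input_def)
    fix a b :: real
    obtain M where "\<forall>y\<in>range (u k). norm y \<le> M" using u k unfolding bounded_input_def bounded_iff by blast
    then show "\<exists>M. AE t in lebesgue. t \<in> {a..b} \<longrightarrow> norm (U t $ k) \<le> M"
      using k by (intro exI[of _ M] AE_I2) (auto simp: U_def)
  qed (simp add: U_def)
  moreover have "solution n A B t0 U X"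
    unfolding solution_def
  proof (intro conjI allI impI)
    show "X t \<in> carrier_vec n" for t by (simp add: X_def)
    show "abs_continuous_on {t0..T} (\<lambda>t. X t $ i)" if "i < n" for i T
      using trajectory_abs_continuous_on[OF x that] that by (simp add: X_def)
    have "AE t in lebesgue. \<forall>N::nat. t \<in> {t0..t0 + real N} \<longrightarrow>
        (\<forall>i<n. (x i has_vector_derivative vector_field u x i t) (at t within {t0..t0 + real N}))"
      unfolding AE_all_countable by (intro allI trajectory_has_vector_derivative[OF x])
    then show "AE t in lebesgue. t0 \<le> t \<longrightarrow>
        (\<forall>i<n. ((\<lambda>s. X s $ i) has_vector_derivative (A t *\<^sub>v X t + B t *\<^sub>v U t) $ i) (at t within {t0..}))"
    proof eventually_elim
      case (elim t)
      show ?case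
      proof (intro impI allI)
        fix i assume t: "t0 \<le> t" and i: "i < n"
        obtain N :: nat where N: "t - t0 < real N" using reals_Archimedean2 by blast
        have At: "A t \<in> carrier_mat n n" and Bt: "B t \<in> carrier_mat n r" using sys by (auto simp: ct_system_def)
        have "(A t *\<^sub>v X t + B t *\<^sub>v U t) $ i = (A t *\<^sub>v X t) $ i + (B t *\<^sub>v U t) $ i"
          using Bt i by (intro index_add_vec(1)) simp
        also have "\<dots> = vector_field u x i t"
          using mult_mat_vec_sum[OF At _ i, of "X t"] mult_mat_vec_sum[OF Bt _ i, of "U t"]
          by (simp add: X_def U_def vector_field_def)
        finally have eq: "(A t *\<^sub>v X t + B t *\<^sub>v U t) $ i = vector_field u x i t" .
        have "(x i has_vector_derivative vector_field u x i t) (at t within {t0..t0 + real N})"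
          using elim[rule_format, of N, OF _ i] t N by simp
        moreover have "at t within {t0..t0 + real N} = at t within {t0..}"
          by (rule at_within_nhd[of t "{..<t0 + real N}"]) (use N in auto)
        ultimately show "((\<lambda>s. X s $ i) has_vector_derivative (A t *\<^sub>v X t + B t *\<^sub>v U t) $ i) (at t within {t0..})"
          unfolding eq using i by (simp add: X_def)
      qed
    qed
  qed
  moreover have "X t0 = x0"
    using trajectory_start[OF x] x0 by (intro eq_vecI) (auto simp: X_def)
  moreover have "X t1 = x1"
    using conjunct2[OF ux] x1 by (intro eq_vecI) (auto simp: X_def)
  ultimately show "can_be_controlled n r A B t0 x0 t1 x1"
    unfolding can_be_controlled_def using x0 x1 \<open>t0 < t1\<close> by auto
qed

lemma mem_pattern_of:
  assumes "X \<in> carrier_mat p q"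
  shows "M \<in> pattern_of X \<longleftrightarrow> M \<in> carrier_mat p q \<and> (\<forall>i<p. \<forall>j<q. M $$ (i, j) \<noteq> 0 \<longleftrightarrow> X $$ (i, j) \<noteq> 0)"
  using assms by (auto simp: pattern_of_def same_nonzeros_def)

lemma patternsE:
  assumes "P \<in> patterns p q"
  obtains X where "X \<in> carrier_mat p q" "P = pattern_of X"
  using assms unfolding patterns_def pattern_of_def by (rule quotientE)

text \<open>The edges of the graph, read off from representatives \<open>X\<close> and \<open>Y\<close> of the two patterns.\<close>

definition graph_edge :: "nat \<Rightarrow> 'a::zero mat \<Rightarrow> 'a mat \<Rightarrow> nat \<Rightarrow> nat \<Rightarrow> bool" where
  "graph_edge n X Y v w \<longleftrightarrow> (if v < n then X $$ (w, v) \<noteq> 0 else Y $$ (w, v - n) \<noteq> 0)"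

lemma is_star_pattern_juxt:
  assumes X: "X \<in> carrier_mat n n" and Y: "Y \<in> carrier_mat n r" and "w < n" "v < n + r"
  shows "is_star (pattern_juxt (pattern_of X) (pattern_of Y)) w v \<longleftrightarrow> graph_edge n X Y v w"
proof -
  have "Z $$ (w, v) \<noteq> 0 \<longleftrightarrow> graph_edge n X Y v w"
    if "X' \<in> pattern_of X" "Y' \<in> pattern_of Y" "Z \<in> pattern_of (juxt_mat X' Y')" for X' Y' Z
  proof -
    have X': "X' \<in> carrier_mat n n" "X' $$ (w, v) \<noteq> 0 \<longleftrightarrow> X $$ (w, v) \<noteq> 0" if "v < n"
      using \<open>X' \<in> pattern_of X\<close> mem_pattern_of[OF X] \<open>w < n\<close> that by auto
    have Y': "Y' \<in> carrier_mat n r" "Y' $$ (w, v - n) \<noteq> 0 \<longleftrightarrow> Y $$ (w, v - n) \<noteq> 0" if "\<not> v < n"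
    proof -
      have "v - n < r" using that \<open>v < n + r\<close> by simp
      then show "Y' \<in> carrier_mat n r" "Y' $$ (w, v - n) \<noteq> 0 \<longleftrightarrow> Y $$ (w, v - n) \<noteq> 0"
        using \<open>Y' \<in> pattern_of Y\<close> mem_pattern_of[OF Y] \<open>w < n\<close> by auto
    qed
    have car: "X' \<in> carrier_mat n n" "Y' \<in> carrier_mat n r"
      using \<open>X' \<in> pattern_of X\<close> \<open>Y' \<in> pattern_of Y\<close> mem_pattern_of[OF X] mem_pattern_of[OF Y] by auto
    then have "juxt_mat X' Y' \<in> carrier_mat n (n + r)" by (simp add: juxt_mat_def)
    then have "Z $$ (w, v) \<noteq> 0 \<longleftrightarrow> juxt_mat X' Y' $$ (w, v) \<noteq> 0"
      using mem_pattern_of that(3) \<open>w < n\<close> \<open>v < n + r\<close> by blast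
    then show ?thesis
      using car X'(2) Y'(2) \<open>w < n\<close> \<open>v < n + r\<close> by (auto simp: juxt_mat_def graph_edge_def)
  qed
  moreover have "X \<in> pattern_of X" "Y \<in> pattern_of Y" "juxt_mat X Y \<in> pattern_of (juxt_mat X Y)"
    by (auto simp: pattern_of_def same_nonzeros_def)
  ultimately show ?thesis unfolding is_star_def pattern_juxt_def by blast
qed

text \<open>Loops are irrelevant, since the vertex \<open>v\<close> lies outside the set that contains its successor.\<close>

lemma sole_successor_property_cong:
  assumes "\<And>v w. v < n + r \<Longrightarrow> w < n \<Longrightarrow> v \<noteq> w \<Longrightarrow> edge v w \<longleftrightarrow> edge' v w"
  shows "sole_successor_property n r edge \<longleftrightarrow> sole_successor_property n r edge'"
proof -
  have "(v < n + r \<and> v \<notin> V \<and> (\<exists>!w. w \<in> V \<and> edge v w)) = (v < n + r \<and> v \<notin> V \<and> (\<exists>!w. w \<in> V \<and> edge' v w))"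
    if V: "V \<subseteq> {..<n}" for V v
  proof (rule conj_cong[OF refl], rule conj_cong[OF refl])
    assume v: "v < n + r" "v \<notin> V"
    have "(w \<in> V \<and> edge v w) = (w \<in> V \<and> edge' v w)" for w
      using assms[OF v(1), of w] V v(2) by (cases "w \<in> V") auto
    then show "(\<exists>!w. w \<in> V \<and> edge v w) = (\<exists>!w. w \<in> V \<and> edge' v w)" by (simp only:)
  qed
  then show ?thesis unfolding sole_successor_property_def by (simp cong: imp_cong conj_cong)
qed

lemma cond_G4_iff:
  assumes "X \<in> carrier_mat n n" "Y \<in> carrier_mat n r"
  shows "cond_G4 n r (pattern_of X) (pattern_of Y) \<longleftrightarrow> sole_successor_property n r (graph_edge n X Y)"
proof -
  let ?E = "pattern_edges n r (pattern_of X) (pattern_of Y)"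
  have "cond_G4 n r (pattern_of X) (pattern_of Y) \<longleftrightarrow> sole_successor_property n r (\<lambda>v w. (v, w) \<in> ?E)"
    unfolding cond_G4_def sole_successor_property_def lessThan_atLeast0
    by (simp only: Bex_def Diff_iff atLeastLessThan_iff le0 simp_thms conj_assoc)
  also have "\<dots> \<longleftrightarrow> sole_successor_property n r (graph_edge n X Y)"
    by (rule sole_successor_property_cong)
       (simp add: pattern_edges_def is_star_pattern_juxt[OF assms])
  finally show ?thesis .
qed

lemma of_pattern_pattern_of:
  assumes "X \<in> carrier_mat n n" "Y \<in> carrier_mat n r"
  shows "of_pattern (pattern_of X) (pattern_of Y) A B \<longleftrightarrow>
    (AE t in lebesgue. A t \<in> carrier_mat n n \<and> B t \<in> carrier_mat n r \<and>
       (\<forall>i<n. \<forall>j<n. A t $$ (i, j) \<noteq> 0 \<longleftrightarrow> graph_edge n X Y j i) \<and>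
       (\<forall>i<n. \<forall>k<r. B t $$ (i, k) \<noteq> 0 \<longleftrightarrow> graph_edge n X Y (n + k) i))"
  unfolding of_pattern_def mem_pattern_of[OF assms(1)] mem_pattern_of[OF assms(2)]
  by (intro arg_cong[where f = "\<lambda>P. AE t in lebesgue. P t"] ext) (auto simp: graph_edge_def)

lemma pattern_add_id:
  fixes X :: "'a::real_normed_field mat"
  assumes X: "X \<in> carrier_mat n n"
  shows "pattern_add (pattern_of (1\<^sub>m n)) (pattern_of X) = pattern_of (abs_mat (1\<^sub>m n) + abs_mat X)"
    and "abs_mat (1\<^sub>m n) + abs_mat X \<in> carrier_mat n n"
    and "\<And>i j. i < n \<Longrightarrow> j < n \<Longrightarrow> (abs_mat (1\<^sub>m n) + abs_mat X) $$ (i, j) \<noteq> 0 \<longleftrightarrow> i = j \<or> X $$ (i, j) \<noteq> 0"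
proof -
  have entry: "(abs_mat I + abs_mat Z) $$ (i, j) \<noteq> 0 \<longleftrightarrow> I $$ (i, j) \<noteq> 0 \<or> Z $$ (i, j) \<noteq> 0"
    if "I \<in> carrier_mat n n" "Z \<in> carrier_mat n n" "i < n" "j < n" for I Z :: "'a mat" and i j
  proof -
    have "(abs_mat I + abs_mat Z) $$ (i, j) = of_real (norm (I $$ (i, j)) + norm (Z $$ (i, j)))"
      using that by (simp add: abs_mat_def)
    then show ?thesis by (simp only: of_real_eq_0_iff) (simp add: add_nonneg_eq_0_iff)
  qed
  have car: "abs_mat I + abs_mat Z \<in> carrier_mat n n"
    if "I \<in> carrier_mat n n" "Z \<in> carrier_mat n n" for I Z :: "'a mat"
    using that by (simp add: abs_mat_def)
  show "abs_mat (1\<^sub>m n) + abs_mat X \<in> carrier_mat n n" by (rule car) (use X in auto)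
  show "(abs_mat (1\<^sub>m n) + abs_mat X) $$ (i, j) \<noteq> 0 \<longleftrightarrow> i = j \<or> X $$ (i, j) \<noteq> 0" if "i < n" "j < n" for i j
    using entry[OF one_carrier_mat X that] that by simp
  have one: "1\<^sub>m n \<in> carrier_mat n n" by simp
  have same: "pattern_of (abs_mat I + abs_mat Z) = pattern_of (abs_mat (1\<^sub>m n) + abs_mat X)"
    if "I \<in> pattern_of (1\<^sub>m n)" "Z \<in> pattern_of X" for I Z :: "'a mat"
  proof -
    have I: "I \<in> carrier_mat n n" "\<And>i j. i < n \<Longrightarrow> j < n \<Longrightarrow> I $$ (i, j) \<noteq> 0 \<longleftrightarrow> 1\<^sub>m n $$ (i, j) \<noteq> (0 :: 'a)"
      using that(1) unfolding mem_pattern_of[OF one] by auto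
    have Z: "Z \<in> carrier_mat n n" "\<And>i j. i < n \<Longrightarrow> j < n \<Longrightarrow> Z $$ (i, j) \<noteq> 0 \<longleftrightarrow> X $$ (i, j) \<noteq> 0"
      using that(2) unfolding mem_pattern_of[OF X] by auto
    show ?thesis
      unfolding set_eq_iff mem_pattern_of[OF car[OF I(1) Z(1)]] mem_pattern_of[OF car[OF one X]]
      using entry[OF I(1) Z(1)] entry[OF one X] I(2) Z(2) by auto
  qed
  have "1\<^sub>m n \<in> pattern_of (1\<^sub>m n :: 'a mat)" "X \<in> pattern_of X"
    by (auto simp: pattern_of_def same_nonzeros_def)
  then show "pattern_add (pattern_of (1\<^sub>m n)) (pattern_of X) = pattern_of (abs_mat (1\<^sub>m n) + abs_mat X)"
    unfolding pattern_add_def using same by blast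
qed

text \<open>The two scalar fields are treated alike.  For (iii), the pattern of \<open>A\<close> is replaced by the one with a
  full diagonal, which leaves the graph condition unchanged.\<close>

lemma structural_controllability:
  fixes P Q :: "'a::{real_normed_field, euclidean_space} mat set"
  assumes "t0 < t1" and P: "P \<in> patterns n n" and Q: "Q \<in> patterns n r"
  shows "(cond_G4 n r P Q \<longleftrightarrow>
          (\<forall>A B. ct_system n r A B \<and> of_pattern P Q A B \<longrightarrow> controllable_on n r A B t0 t1)) \<and>
        (cond_G4 n r P Q \<longleftrightarrow>
          (\<forall>A B. ct_system n r A B \<and> exponentially_scaled n r A B \<and> of_pattern P Q A B \<longrightarrow>
             controllable_on n r A B t0 t1)) \<and>
        (cond_G4 n r P Q \<longleftrightarrow>
          (\<forall>A B. ct_system n r A B \<and> time_invariant A B \<and>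
             of_pattern (pattern_add (pattern_of (1\<^sub>m n)) P) Q A B \<longrightarrow> controllable n r A B))"
    (is "(?G \<longleftrightarrow> ?i) \<and> (?G \<longleftrightarrow> ?ii) \<and> (?G \<longleftrightarrow> ?iii)")
proof -
  obtain X where X: "X \<in> carrier_mat n n" "P = pattern_of X" by (rule patternsE[OF P])
  obtain Y where Y: "Y \<in> carrier_mat n r" "Q = pattern_of Y" by (rule patternsE[OF Q])
  define X' where "X' = abs_mat (1\<^sub>m n) + abs_mat X"
  note X' = pattern_add_id[OF X(1), folded X'_def X(2)]
  let ?e = "graph_edge n X Y" and ?e' = "graph_edge n X' Y"
  have G: "?G \<longleftrightarrow> sole_successor_property n r ?e" unfolding X(2) Y(2) by (rule cond_G4_iff[OF X(1) Y(1)])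
  have G': "?G \<longleftrightarrow> sole_successor_property n r ?e'"
    unfolding G by (rule sole_successor_property_cong) (auto simp: graph_edge_def X'(3))
  have sufficient: "controllable_on n r A B s0 s1"
    if "s0 < s1" "ct_system n r A B" "Z \<in> carrier_mat n n" "of_pattern (pattern_of Z) Q A B"
      "sole_successor_property n r (graph_edge n Z Y)" for A B Z s0 s1
  proof (rule ct_system_controllable_on[OF that(2,1,5)])
    note pat = that(4)[unfolded Y(2) of_pattern_pattern_of[OF that(3) Y(1)]]
    from pat show "AE t in lebesgue. \<forall>i<n. \<forall>j<n. A t $$ (i, j) \<noteq> 0 \<longleftrightarrow> graph_edge n Z Y j i"
      by eventually_elim blast
    from pat show "AE t in lebesgue. \<forall>i<n. \<forall>k<r. B t $$ (i, k) \<noteq> 0 \<longleftrightarrow> graph_edge n Z Y (n + k) i"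
      by eventually_elim blast
  qed
  have "?G \<longrightarrow> ?i" using sufficient[OF \<open>t0 < t1\<close> _ X(1)] G unfolding X(2) by blast
  moreover have "?i \<longrightarrow> ?ii" by blast
  moreover have "?ii \<longrightarrow> ?G"
  proof (rule ccontr)
    assume "\<not> (?ii \<longrightarrow> ?G)"
    then have ii: "?ii" and "\<not> sole_successor_property n r ?e" unfolding G by simp_all
    from exponentially_scaled_uncontrollable[OF this(2)] obtain A B :: "real \<Rightarrow> 'a mat" and x0 x1 where
      AB: "exponentially_scaled n r A B" "ct_system n r A B"
      "\<forall>t. (\<forall>i<n. \<forall>j<n. A t $$ (i, j) \<noteq> 0 \<longleftrightarrow> ?e j i) \<and> (\<forall>i<n. \<forall>k<r. B t $$ (i, k) \<noteq> 0 \<longleftrightarrow> ?e (n + k) i)"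
      "x0 \<in> carrier_vec n" "x1 \<in> carrier_vec n" "\<forall>\<tau>0 \<tau>1. \<not> can_be_controlled n r A B \<tau>0 x0 \<tau>1 x1"
      by (elim exE conjE) (rule that)
    have "of_pattern P Q A B"
      unfolding X(2) Y(2) of_pattern_pattern_of[OF X(1) Y(1)]
      using AB(2,3) by (intro AE_I2) (auto simp: ct_system_def)
    then have "controllable_on n r A B t0 t1" using ii AB(1,2) by blast
    then show False using AB(4-6) unfolding controllable_on_def by blast
  qed
  moreover have "?G \<longrightarrow> ?iii"
  proof (intro impI allI)
    fix A B assume g: "?G" and AB: "ct_system n r A B \<and> time_invariant A B \<and>
      of_pattern (pattern_add (pattern_of (1\<^sub>m n)) P) Q A B"
    have "controllable_on n r A B 0 1"
      by (rule sufficient[OF _ _ X'(2)]) (use AB X'(1) g G' in auto)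
    then show "controllable n r A B" unfolding controllable_on_def controllable_def by blast
  qed
  moreover have "?iii \<longrightarrow> ?G"
  proof (rule ccontr)
    assume "\<not> (?iii \<longrightarrow> ?G)"
    then have iii: "?iii" and "\<not> sole_successor_property n r ?e'" unfolding G' by simp_all
    from time_invariant_uncontrollable[OF this(2)] obtain A B :: "'a mat" and x0 x1 where
      AB: "A \<in> carrier_mat n n" "B \<in> carrier_mat n r"
      "\<forall>i<n. \<forall>j<n. A $$ (i, j) \<noteq> 0 \<longleftrightarrow> i = j \<or> ?e' j i" "\<forall>i<n. \<forall>k<r. B $$ (i, k) \<noteq> 0 \<longleftrightarrow> ?e' (n + k) i"
      "x0 \<in> carrier_vec n" "x1 \<in> carrier_vec n" "\<forall>\<tau>0 \<tau>1. \<not> can_be_controlled n r (\<lambda>t. A) (\<lambda>t. B) \<tau>0 x0 \<tau>1 x1"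
      by (elim exE conjE) (rule that)
    have "of_pattern (pattern_add (pattern_of (1\<^sub>m n)) P) Q (\<lambda>t. A) (\<lambda>t. B)"
      unfolding X'(1) Y(2) of_pattern_pattern_of[OF X'(2) Y(1)]
      using AB(1-4) X'(3) by (intro AE_I2) (auto simp: graph_edge_def)
    moreover have "ct_system n r (\<lambda>t. A) (\<lambda>t. B)"
      using AB(1,2) by (auto simp: ct_system_def locally_integrable_def absolutely_integrable_continuous_real)
    moreover have "time_invariant (\<lambda>t::real. A) (\<lambda>t. B)" by (auto simp: time_invariant_def)
    ultimately have "controllable n r (\<lambda>t. A) (\<lambda>t. B)" using iii by blast
    then show False using AB(5-7) unfolding controllable_def by blast
  qed
  ultimately show ?thesis by blast
qed

theorem theorem3:
  fixes n r :: nat and t0 t1 :: real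
  assumes "n \<ge> 1" and "t0 < t1"
  shows
    "(\<forall>P \<in> (patterns n n :: real mat set set). \<forall>Q \<in> (patterns n r :: real mat set set).
        (cond_G4 n r P Q \<longleftrightarrow>
          (\<forall>A B. ct_system n r A B \<and> of_pattern P Q A B \<longrightarrow> controllable_on n r A B t0 t1)) \<and>
        (cond_G4 n r P Q \<longleftrightarrow>
          (\<forall>A B. ct_system n r A B \<and> exponentially_scaled n r A B \<and> of_pattern P Q A B \<longrightarrow>
             controllable_on n r A B t0 t1)) \<and>
        (cond_G4 n r P Q \<longleftrightarrow>
          (\<forall>A B. ct_system n r A B \<and> time_invariant A B \<and>
             of_pattern (pattern_add (pattern_of (1\<^sub>m n)) P) Q A B \<longrightarrow> controllable n r A B))) \<and>
     (\<forall>P \<in> (patterns n n :: complex mat set set). \<forall>Q \<in> (patterns n r :: complex mat set set).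
        (cond_G4 n r P Q \<longleftrightarrow>
          (\<forall>A B. ct_system n r A B \<and> of_pattern P Q A B \<longrightarrow> controllable_on n r A B t0 t1)) \<and>
        (cond_G4 n r P Q \<longleftrightarrow>
          (\<forall>A B. ct_system n r A B \<and> exponentially_scaled n r A B \<and> of_pattern P Q A B \<longrightarrow>
             controllable_on n r A B t0 t1)) \<and>
        (cond_G4 n r P Q \<longleftrightarrow>
          (\<forall>A B. ct_system n r A B \<and> time_invariant A B \<and>
             of_pattern (pattern_add (pattern_of (1\<^sub>m n)) P) Q A B \<longrightarrow> controllable n r A B)))"
  by (intro conjI[OF ballI[OF ballI] ballI[OF ballI]] structural_controllability[OF \<open>t0 < t1\<close>])

end
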